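(* For any $S$-transport (of class $C^1$) along a ($C^1$) path $\gamma:J\to M$ there exists a unique derivation $\mathcal{D}^\gamma$ of the restricted along $\gamma$ tensor algebra which generates the components $\Gamma^\gamma(s):=[\Gamma^i_{\ j}(s;\gamma)]$ of the $S$-transport in a basis $\{E_i|_{\gamma(s)}\}$, $s\in J$, through the equation $$\mathcal{D}^\gamma E_i=\Gamma^k_{\ i}(s;\gamma)E_k ,$$ where both sides are taken at $\gamma(s)$, $s\in J$.
   Context: $M$ is a real differentiable manifold of class $C^1$ and dimension $n$; $J$ is a real interval. Summation from $1$ to $n$ over repeated indices is understood. $T^{p,q}_x(M)$ is the space of tensors of type $(p,q)$ at $x\in M$, with $T^{0,0}_x(M)=\mathbb{R}$. A tensor field on $\gamma(J)$ assigns to each point $x\in\gamma(J)$ a tensor at $x$. The $E_i$ are vector fields on $\gamma(J)$ such that $\{E_i|_{\gamma(s)}\}$ is a basis of the tangent space at $\gamma(s)$ for every $s\in J$. A derivation of the restricted along $\gamma$ tensor algebra (the restriction of the tensor algebra over $M$ on $\gamma(J)$) is a type-preserving map $\mathcal{D}^\gamma$, taking $C^1$ tensor fields on $\gamma(J)$ into tensor fields on $\gamma(J)$, such that $\mathcal{D}^\gamma(\lambda A+\mu A')=\lambda\mathcal{D}^\gamma A+\mu\mathcal{D}^\gamma A'$ for $\lambda,\mu\in\mathbb{R}$; $\mathcal{D}^\gamma\circ C=C\circ\mathcal{D}^\gamma$ for a contraction operator $C$; and $\mathcal{D}^\gamma(A\otimes B)=(\mathcal{D}^\gamma A)\otimes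 B+A\otimes(\mathcal{D}^\gamma B)$, where $A,A',B$ are $C^1$ tensor fields on $\gamma(J)$, the types of $A$ and $A'$ being the same. An $S$-transport along $\gamma:J\to M$ is a map $S^\gamma:(s,t)\mapsto S^\gamma_{s\to t}$, $(s,t)\in J\times J$, where $S^\gamma_{s\to t}$ maps the tensor algebra at $\gamma(s)$ into the tensor algebra at $\gamma(t)$ and satisfies: (1) $S^\gamma_{s\to t}(T^{p,q}_{\gamma(s)}(M))\subseteq T^{p,q}_{\gamma(t)}(M)$; (2) $S^\gamma_{s\to t}$ is $\mathbb{R}$-linear on each $T^{p,q}_{\gamma(s)}(M)$; (3) $S^\gamma_{s\to t}(A_1\otimes A_2)=(S^\gamma_{s\to t}A_1)\otimes(S^\gamma_{s\to t}A_2)$; (4) $S^\gamma_{s\to t}\circ C=C\circ S^\gamma_{s\to t}$ for any contraction operator $C$; (5) $S^\gamma_{t\to r}\circ S^\gamma_{s\to t}=S^\gamma_{s\to r}$ for $r,s,t\in J$; (6) $S^\gamma_{s\to s}=\mathrm{id}$. The matrix $H(t,s;\gamma)=[H^i_{\ j}(t,s;\gamma)]$ of $S^\gamma$ in the basis $\{E_i|_{\gamma(s)}\}$ is defined by $S^\gamma_{s\to t}(E_j|_{\gamma(s)})=H^i_{\ j}(t,s;\gamma)E_i|_{\gamma(t)}$; $S^\gamma$ is of class $C^1$ if $H(t,s;\gamma)$ is of class $C^1$ with respect to $t$ (or, equivalently, to $s$). The components of the $S$-transport in this basis are $\Gamma^i_{\ j}(s;\gamma):=\frac{\partial H^i_{\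 j}(s,t;\gamma)}{\partial t}\big|_{t=s}=-\frac{\partial H^i_{\ j}(t,s;\gamma)}{\partial t}\big|_{t=s}$.
   Formalization: Uniqueness is among derivations generating the components in every C^1 basis, or in the given basis with D f = df/ds on functions; tensor fields on γ(J) are functions of s, C^1 meaning C^1 components in {E_i}; J has nonempty interior and n ≥ 1. *)

theory Defs
  imports "HOL-Analysis.Analysis" "HOL-Library.Function_Algebras"
begin

text \<open>Tangent vectors, covectors and tensors are represented by functions, with the pointwise
  real vector space structure; the spaces they form at a point are subspaces of function spaces.\<close>

instantiation "fun" :: (type, real_vector) real_vector
begin

definition scaleR_fun_def: "scaleR a f = (\<lambda>x. a *\<^sub>R f x)"

instance
  by standard
    (simp_all add: scaleR_fun_def plus_fun_def fun_eq_iff scaleR_add_right scaleR_add_left)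

end

definition real_linear_on :: "'a::real_vector set \<Rightarrow> ('a \<Rightarrow> 'b::real_vector) \<Rightarrow> bool" where
  "real_linear_on V f \<longleftrightarrow>
     (\<forall>v\<in>V. \<forall>w\<in>V. \<forall>a b. f (a *\<^sub>R v + b *\<^sub>R w) = a *\<^sub>R f v + b *\<^sub>R f w)"

text \<open>At an end point belonging to the interval \<open>J\<close> the derivative is one-sided.\<close>

definition C1_on :: "real set \<Rightarrow> (real \<Rightarrow> 'a::real_normed_vector) \<Rightarrow> bool" where
  "C1_on J f \<longleftrightarrow>
     (\<exists>f'. (\<forall>s\<in>J. (f has_vector_derivative f' s) (at s within J)) \<and> continuous_on J f')"

definition C1_on_open ::
  "'a::real_normed_vector set \<Rightarrow> ('a \<Rightarrow> 'b::real_normed_vector) \<Rightarrow> bool" where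
  "C1_on_open W f \<longleftrightarrow> open W \<and>
     (\<exists>f' :: 'a \<Rightarrow> 'a \<Rightarrow>\<^sub>L 'b.
        (\<forall>x\<in>W. (f has_derivative blinfun_apply (f' x)) (at x)) \<and> continuous_on W f')"


section \<open>Manifolds of class \<open>C\<^sup>1\<close>\<close>

type_synonym ('m, 'n) chart = "'m set \<times> ('m \<Rightarrow> real ^ 'n)"

definition is_chart :: "'m topology \<Rightarrow> ('m, 'n::finite) chart \<Rightarrow> bool" where
  "is_chart X c \<longleftrightarrow> openin X (fst c) \<and> open (snd c ` fst c) \<and>
     homeomorphic_map (subtopology X (fst c)) (top_of_set (snd c ` fst c)) (snd c)"

definition transition :: "('m, 'n::finite) chart \<Rightarrow> ('m, 'n) chart \<Rightarrow> real ^ 'n \<Rightarrow> real ^ 'n" where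
  "transition c d = snd d \<circ> inv_into (fst c) (snd c)"

text \<open>The atlas need not be maximal, and second countability is not imposed; the dimension
  is \<open>CARD('n) \<ge> 1\<close>.\<close>

definition C1_manifold :: "'m topology \<Rightarrow> ('m, 'n::finite) chart set \<Rightarrow> bool" where
  "C1_manifold X \<A> \<longleftrightarrow> Hausdorff_space X \<and> (\<forall>c\<in>\<A>. is_chart X c) \<and>
     (\<Union>c\<in>\<A>. fst c) = topspace X \<and>
     (\<forall>c\<in>\<A>. \<forall>d\<in>\<A>. C1_on_open (snd c ` (fst c \<inter> fst d)) (transition c d))"

definition C1_path ::
  "'m topology \<Rightarrow> ('m, 'n::finite) chart set \<Rightarrow> real set \<Rightarrow> (real \<Rightarrow> 'm) \<Rightarrow> bool" where
  "C1_path X \<A> J \<gamma> \<longleftrightarrow> continuous_map (top_of_set J) X \<gamma> \<and>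
     (\<forall>c\<in>\<A>. C1_on {s \<in> J. \<gamma> s \<in> fst c} (snd c \<circ> \<gamma>))"


section \<open>Tangent vectors and tensors at a point\<close>

text \<open>A tangent vector at \<open>x\<close> is given by its components in all charts around \<open>x\<close>, which are
  related by the Jacobians of the transition maps. (Derivations of germs cannot be used: on germs
  of class \<open>C\<^sup>1\<close> they form an infinite-dimensional space.)\<close>

type_synonym ('m, 'n) tvec = "('m, 'n) chart \<Rightarrow> real ^ 'n"

definition tangent_space :: "('m, 'n::finite) chart set \<Rightarrow> 'm \<Rightarrow> ('m, 'n) tvec set" where
  "tangent_space \<A> x =
     {v. (\<forall>c. \<not> (c \<in> \<A> \<and> x \<in> fst c) \<longrightarrow> v c = 0) \<and>
         (\<forall>c\<in>\<A>. \<forall>d\<in>\<A>. x \<in> fst c \<and> x \<in> fst d \<longrightarrow>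
            v d = frechet_derivative (transition c d) (at (snd c x)) (v c))}"

type_synonym ('m, 'n) covec = "('m, 'n) tvec \<Rightarrow> real"

definition cotangent_space :: "('m, 'n::finite) chart set \<Rightarrow> 'm \<Rightarrow> ('m, 'n) covec set" where
  "cotangent_space \<A> x =
     {\<omega>. real_linear_on (tangent_space \<A> x) \<omega> \<and> (\<forall>v. v \<notin> tangent_space \<A> x \<longrightarrow> \<omega> v = 0)}"

definition tuples :: "'a set \<Rightarrow> nat \<Rightarrow> 'a list set" where
  "tuples V k = {xs. set xs \<subseteq> V \<and> length xs = k}"

text \<open>A tensor of type \<open>(p,q)\<close> at \<open>x\<close> is a multilinear function of \<open>p\<close> covectors and \<open>q\<close> vectors,
  continued by zero to all other pairs of lists. A real number \<open>r\<close> is identified with the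
  tensor of type \<open>(0,0)\<close> whose value on the pair of empty lists is \<open>r\<close>. The spaces of different
  types have only \<open>0\<close> in common and their sum is direct, so that this sum is the tensor algebra
  at \<open>x\<close>.\<close>

type_synonym ('m, 'n) tensor = "('m, 'n) covec list \<Rightarrow> ('m, 'n) tvec list \<Rightarrow> real"

definition tensor_space ::
  "('m, 'n::finite) chart set \<Rightarrow> 'm \<Rightarrow> nat \<Rightarrow> nat \<Rightarrow> ('m, 'n) tensor set" where
  "tensor_space \<A> x p q =
     {A. (\<forall>\<omega>s vs. \<not> (\<omega>s \<in> tuples (cotangent_space \<A> x) p \<and> vs \<in> tuples (tangent_space \<A> x) q)
            \<longrightarrow> A \<omega>s vs = 0) \<and>
         (\<forall>\<omega>s \<in> tuples (cotangent_space \<A> x) p. \<forall>vs \<in> tuples (tangent_space \<A> x) q.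
            (\<forall>i<p. real_linear_on (cotangent_space \<A> x) (\<lambda>\<omega>. A (\<omega>s[i := \<omega>]) vs)) \<and>
            (\<forall>j<q. real_linear_on (tangent_space \<A> x) (\<lambda>v. A \<omega>s (vs[j := v]))))}"

definition scalar_tensor :: "real \<Rightarrow> ('m, 'n::finite) tensor" where
  "scalar_tensor r = (\<lambda>\<omega>s vs. if \<omega>s = [] \<and> vs = [] then r else 0)"

text \<open>The identification of tangent vectors with tensors of type \<open>(1,0)\<close>.\<close>

definition vector_tensor ::
  "('m, 'n::finite) chart set \<Rightarrow> 'm \<Rightarrow> ('m, 'n) tvec \<Rightarrow> ('m, 'n) tensor" where
  "vector_tensor \<A> x v =
     (\<lambda>\<omega>s vs. if \<omega>s \<in> tuples (cotangent_space \<A> x) 1 \<and> vs = [] then hd \<omega>s v else 0)"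

text \<open>Here \<open>(p,q)\<close> is the type of the left factor.\<close>

definition tensor_prod ::
  "nat \<Rightarrow> nat \<Rightarrow> ('m, 'n::finite) tensor \<Rightarrow> ('m, 'n) tensor \<Rightarrow> ('m, 'n) tensor" where
  "tensor_prod p q A B =
     (\<lambda>\<omega>s vs. A (take p \<omega>s) (take q vs) * B (drop p \<omega>s) (drop q vs))"

definition basis_at :: "('m, 'n::finite) chart set \<Rightarrow> 'm \<Rightarrow> ('n \<Rightarrow> ('m, 'n) tvec) \<Rightarrow> bool" where
  "basis_at \<A> x e \<longleftrightarrow>
     inj e \<and> independent (range e) \<and> span (range e) = tangent_space \<A> x"

definition dual_basis ::
  "('m, 'n::finite) chart set \<Rightarrow> 'm \<Rightarrow> ('n \<Rightarrow> ('m, 'n) tvec) \<Rightarrow> 'n \<Rightarrow> ('m, 'n) covec" where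
  "dual_basis \<A> x e i =
     (THE \<omega>. \<omega> \<in> cotangent_space \<A> x \<and> (\<forall>j. \<omega> (e j) = (if i = j then 1 else 0)))"

definition insert_at :: "nat \<Rightarrow> 'a \<Rightarrow> 'a list \<Rightarrow> 'a list" where
  "insert_at i a xs = take i xs @ a # drop i xs"

text \<open>The contraction of the \<open>i\<close>-th contravariant with the \<open>j\<close>-th covariant argument (counted
  from zero). It does not depend on the basis used to compute it.\<close>

definition contract ::
  "('m, 'n::finite) chart set \<Rightarrow> 'm \<Rightarrow> nat \<Rightarrow> nat \<Rightarrow> ('m, 'n) tensor \<Rightarrow> ('m, 'n) tensor" where
  "contract \<A> x i j A =
     (let e = (SOME e. basis_at \<A> x e) in
      (\<lambda>\<omega>s vs. \<Sum>k\<in>UNIV. A (insert_at i (dual_basis \<A> x e k) \<omega>s) (insert_at j (e k) vs)))"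


section \<open>\<open>S\<close>-transports\<close>

text \<open>\<open>S s t\<close> is the map \<open>S\<^sub>s\<^sub>\<rightarrow>\<^sub>t\<close>. Since all conditions are imposed type by type, only its values
  on homogeneous tensors matter.\<close>

definition S_transport ::
  "('m, 'n::finite) chart set \<Rightarrow> real set \<Rightarrow> (real \<Rightarrow> 'm) \<Rightarrow>
     (real \<Rightarrow> real \<Rightarrow> ('m, 'n) tensor \<Rightarrow> ('m, 'n) tensor) \<Rightarrow> bool" where
  "S_transport \<A> J \<gamma> S \<longleftrightarrow>
     (\<forall>s\<in>J. \<forall>t\<in>J. \<forall>p q. S s t ` tensor_space \<A> (\<gamma> s) p q \<subseteq> tensor_space \<A> (\<gamma> t) p q) \<and>
     (\<forall>s\<in>J. \<forall>t\<in>J. \<forall>p q. real_linear_on (tensor_space \<A> (\<gamma> s) p q) (S s t)) \<and>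
     (\<forall>s\<in>J. \<forall>t\<in>J. \<forall>p q p' q'.
        \<forall>A \<in> tensor_space \<A> (\<gamma> s) p q. \<forall>B \<in> tensor_space \<A> (\<gamma> s) p' q'.
          S s t (tensor_prod p q A B) = tensor_prod p q (S s t A) (S s t B)) \<and>
     (\<forall>s\<in>J. \<forall>t\<in>J. \<forall>p q. \<forall>i<p. \<forall>j<q. \<forall>A \<in> tensor_space \<A> (\<gamma> s) p q.
          S s t (contract \<A> (\<gamma> s) i j A) = contract \<A> (\<gamma> t) i j (S s t A)) \<and>
     (\<forall>s\<in>J. \<forall>t\<in>J. \<forall>r\<in>J. \<forall>p q. \<forall>A \<in> tensor_space \<A> (\<gamma> s) p q.
          S t r (S s t A) = S s r A) \<and>
     (\<forall>s\<in>J. \<forall>p q. \<forall>A \<in> tensor_space \<A> (\<gamma> s) p q. S s s A = A)"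

definition frame_along ::
  "('m, 'n::finite) chart set \<Rightarrow> real set \<Rightarrow> (real \<Rightarrow> 'm) \<Rightarrow>
     (real \<Rightarrow> 'n \<Rightarrow> ('m, 'n) tvec) \<Rightarrow> bool" where
  "frame_along \<A> J \<gamma> E \<longleftrightarrow> (\<forall>s\<in>J. basis_at \<A> (\<gamma> s) (E s))"

text \<open>\<open>transport_matrix \<A> \<gamma> E S t s\<close> is the matrix \<open>H(t,s;\<gamma>)\<close> of \<open>S\<^sub>s\<^sub>\<rightarrow>\<^sub>t\<close>; note the order of the
  arguments.\<close>

definition transport_matrix ::
  "('m, 'n::finite) chart set \<Rightarrow> (real \<Rightarrow> 'm) \<Rightarrow> (real \<Rightarrow> 'n \<Rightarrow> ('m, 'n) tvec) \<Rightarrow>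
     (real \<Rightarrow> real \<Rightarrow> ('m, 'n) tensor \<Rightarrow> ('m, 'n) tensor) \<Rightarrow> real \<Rightarrow> real \<Rightarrow> real ^ 'n ^ 'n" where
  "transport_matrix \<A> \<gamma> E S t s =
     (THE H. \<forall>j. S s t (vector_tensor \<A> (\<gamma> s) (E s j)) =
                 (\<Sum>i\<in>UNIV. (H $ i $ j) *\<^sub>R vector_tensor \<A> (\<gamma> t) (E t i)))"

definition C1_transport ::
  "('m, 'n::finite) chart set \<Rightarrow> real set \<Rightarrow> (real \<Rightarrow> 'm) \<Rightarrow>
     (real \<Rightarrow> 'n \<Rightarrow> ('m, 'n) tvec) \<Rightarrow>
     (real \<Rightarrow> real \<Rightarrow> ('m, 'n) tensor \<Rightarrow> ('m, 'n) tensor) \<Rightarrow> bool" where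
  "C1_transport \<A> J \<gamma> E S \<longleftrightarrow>
     S_transport \<A> J \<gamma> S \<and> (\<forall>s\<in>J. C1_on J (\<lambda>t. transport_matrix \<A> \<gamma> E S t s))"

definition transport_components ::
  "('m, 'n::finite) chart set \<Rightarrow> real set \<Rightarrow> (real \<Rightarrow> 'm) \<Rightarrow>
     (real \<Rightarrow> 'n \<Rightarrow> ('m, 'n) tvec) \<Rightarrow>
     (real \<Rightarrow> real \<Rightarrow> ('m, 'n) tensor \<Rightarrow> ('m, 'n) tensor) \<Rightarrow> real \<Rightarrow> real ^ 'n ^ 'n" where
  "transport_components \<A> J \<gamma> E S s =
     vector_derivative (\<lambda>t. transport_matrix \<A> \<gamma> E S s t) (at s within J)"


section \<open>Tensor fields along a path and derivations\<close>

text \<open>A tensor field on \<open>\<gamma>(J)\<close> is a function of the parameter whose value at \<open>s\<close> is a tensor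
  at \<open>\<gamma>(s)\<close>. For injective \<open>\<gamma>\<close> these are the functions of the points of \<open>\<gamma>(J)\<close> (see the lemma
  below). At a self-intersection point, where the components of a transport may take
  different values on the different branches, a field may do so too. Outside \<open>J\<close> fields are \<open>0\<close>
  by convention.\<close>

type_synonym ('m, 'n) tensor_field = "real \<Rightarrow> ('m, 'n) tensor"

definition tensor_fields ::
  "('m, 'n::finite) chart set \<Rightarrow> real set \<Rightarrow> (real \<Rightarrow> 'm) \<Rightarrow> nat \<Rightarrow> nat \<Rightarrow>
     ('m, 'n) tensor_field set" where
  "tensor_fields \<A> J \<gamma> p q =
     {A. (\<forall>s\<in>J. A s \<in> tensor_space \<A> (\<gamma> s) p q) \<and> (\<forall>s. s \<notin> J \<longrightarrow> A s = 0)}"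

lemma tensor_fields_on_image:
  assumes "inj_on \<gamma> J"
  shows "bij_betw (\<lambda>A s. if s \<in> J then A (\<gamma> s) else 0)
           {A. (\<forall>x\<in>\<gamma> ` J. A x \<in> tensor_space \<A> x p q) \<and> (\<forall>x. x \<notin> \<gamma> ` J \<longrightarrow> A x = 0)}
           (tensor_fields \<A> J \<gamma> p q)"
proof (rule bij_betw_byWitness
         [where f' = "\<lambda>B x. if x \<in> \<gamma> ` J then B (inv_into J \<gamma> x) else 0"])
qed (use assms in \<open>auto simp: tensor_fields_def fun_eq_iff inv_into_f_f\<close>)

text \<open>On a manifold of class \<open>C\<^sup>1\<close> the Jacobians of the transition maps are merely continuous, so
  differentiability of the components of a field in charts is not an invariant notion. The frame
  \<open>E\<close> in which the transport is of class \<open>C\<^sup>1\<close> is taken as reference instead.\<close>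

definition C1_fields ::
  "('m, 'n::finite) chart set \<Rightarrow> real set \<Rightarrow> (real \<Rightarrow> 'm) \<Rightarrow>
     (real \<Rightarrow> 'n \<Rightarrow> ('m, 'n) tvec) \<Rightarrow> nat \<Rightarrow> nat \<Rightarrow> ('m, 'n) tensor_field set" where
  "C1_fields \<A> J \<gamma> E p q =
     {A \<in> tensor_fields \<A> J \<gamma> p q. \<forall>is js. length is = p \<and> length js = q \<longrightarrow>
        C1_on J (\<lambda>s. A s (map (dual_basis \<A> (\<gamma> s) (E s)) is) (map (E s) js))}"

definition vector_field ::
  "('m, 'n::finite) chart set \<Rightarrow> real set \<Rightarrow> (real \<Rightarrow> 'm) \<Rightarrow>
     (real \<Rightarrow> 'n \<Rightarrow> ('m, 'n) tvec) \<Rightarrow> 'n \<Rightarrow> ('m, 'n) tensor_field" where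
  "vector_field \<A> J \<gamma> F i = (\<lambda>s. if s \<in> J then vector_tensor \<A> (\<gamma> s) (F s i) else 0)"

definition scalar_field :: "real set \<Rightarrow> (real \<Rightarrow> real) \<Rightarrow> ('m, 'n::finite) tensor_field" where
  "scalar_field J f = (\<lambda>s. if s \<in> J then scalar_tensor (f s) else 0)"

definition C1_frame ::
  "('m, 'n::finite) chart set \<Rightarrow> real set \<Rightarrow> (real \<Rightarrow> 'm) \<Rightarrow>
     (real \<Rightarrow> 'n \<Rightarrow> ('m, 'n) tvec) \<Rightarrow> (real \<Rightarrow> 'n \<Rightarrow> ('m, 'n) tvec) \<Rightarrow> bool" where
  "C1_frame \<A> J \<gamma> E F \<longleftrightarrow>
     frame_along \<A> J \<gamma> F \<and> (\<forall>i. vector_field \<A> J \<gamma> F i \<in> C1_fields \<A> J \<gamma> E 1 0)"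

text \<open>The last conjunct fixes the values of \<open>D\<close> outside its domain, so that equality of
  derivations is equality of functions.\<close>

definition derivation_along ::
  "('m, 'n::finite) chart set \<Rightarrow> real set \<Rightarrow> (real \<Rightarrow> 'm) \<Rightarrow>
     (real \<Rightarrow> 'n \<Rightarrow> ('m, 'n) tvec) \<Rightarrow>
     (('m, 'n) tensor_field \<Rightarrow> ('m, 'n) tensor_field) \<Rightarrow> bool" where
  "derivation_along \<A> J \<gamma> E D \<longleftrightarrow>
     (\<forall>p q. D ` C1_fields \<A> J \<gamma> E p q \<subseteq> tensor_fields \<A> J \<gamma> p q) \<and>
     (\<forall>p q. real_linear_on (C1_fields \<A> J \<gamma> E p q) D) \<and>
     (\<forall>p q. \<forall>i<p. \<forall>j<q. \<forall>A \<in> C1_fields \<A> J \<gamma> E p q.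
        D (\<lambda>s. contract \<A> (\<gamma> s) i j (A s)) = (\<lambda>s. contract \<A> (\<gamma> s) i j (D A s))) \<and>
     (\<forall>p q p' q'. \<forall>A \<in> C1_fields \<A> J \<gamma> E p q. \<forall>B \<in> C1_fields \<A> J \<gamma> E p' q'.
        D (\<lambda>s. tensor_prod p q (A s) (B s)) =
          (\<lambda>s. tensor_prod p q (D A s) (B s) + tensor_prod p q (A s) (D B s))) \<and>
     D \<in> extensional (\<Union>p q. C1_fields \<A> J \<gamma> E p q)"

definition generates_components ::
  "('m, 'n::finite) chart set \<Rightarrow> real set \<Rightarrow> (real \<Rightarrow> 'm) \<Rightarrow>
     (real \<Rightarrow> real \<Rightarrow> ('m, 'n) tensor \<Rightarrow> ('m, 'n) tensor) \<Rightarrow>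
     (real \<Rightarrow> 'n \<Rightarrow> ('m, 'n) tvec) \<Rightarrow>
     (('m, 'n) tensor_field \<Rightarrow> ('m, 'n) tensor_field) \<Rightarrow> bool" where
  "generates_components \<A> J \<gamma> S F D \<longleftrightarrow>
     (\<forall>i. \<forall>s\<in>J. D (vector_field \<A> J \<gamma> F i) s =
        (\<Sum>k\<in>UNIV. (transport_components \<A> J \<gamma> F S s $ k $ i) *\<^sub>R vector_field \<A> J \<gamma> F k s))"

text \<open>The axioms of a derivation do not determine its action on functions: if \<open>D\<close> generates the
  components in one basis, so does the derivation with the same values on this basis which
  annihilates all functions. Therefore \<open>D\<close> is unique only if it generates the components in every
  basis of class \<open>C\<^sup>1\<close> (whose changes then force \<open>D f = df/ds\<close>), or, with one fixed basis, if
  \<open>D f = df/ds\<close> is required.\<close>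

definition differentiates_functions ::
  "real set \<Rightarrow> (('m, 'n::finite) tensor_field \<Rightarrow> ('m, 'n) tensor_field) \<Rightarrow> bool" where
  "differentiates_functions J D \<longleftrightarrow>
     (\<forall>f. C1_on J f \<longrightarrow>
        D (scalar_field J f) = scalar_field J (\<lambda>s. vector_derivative f (at s within J)))"

end

theory Submission
  imports Defs
begin

text \<open>Fix a point \<open>s\<^sub>0\<close> of \<open>J\<close> and transport the basis \<open>E\<^sub>j\<close> at \<open>\<gamma>(s\<^sub>0)\<close> along the path. The
  resulting frame \<open>G\<close> is parallel: \<open>S\<close> maps its elements at one point to its elements at another,
  by the composition law of the transport (lemma \<open>parallel_frame_exists\<close>). Its matrix with respect
  to \<open>E\<close> is \<open>H(s,s\<^sub>0)\<close>, which is of class \<open>C\<^sup>1\<close> together with its inverse; hence a field has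
  components of class \<open>C\<^sup>1\<close> in \<open>G\<close> if and only if it has such components in \<open>E\<close> (lemma
  \<open>C1_fields_change\<close>).

  Existence: in the frame \<open>G\<close> the derivation sought is the derivative of the components, that is,
  \<open>(D A)(s)\<close> is the derivative of \<open>S\<^sub>t\<^sub>\<rightarrow>\<^sub>s A(t)\<close> at \<open>t = s\<close>. No components of the transport occur in this
  definition, and the axioms of a derivation reduce to the rules for differentiating sums and
  products of real functions (lemma \<open>frame_derivation_derivation\<close>). For a frame \<open>F\<close> of class \<open>C\<^sup>1\<close>
  one has \<open>S\<^sub>t\<^sub>\<rightarrow>\<^sub>s F\<^sub>i(t) = H\<^sup>k\<^sub>i(s,t) F\<^sub>k(s)\<close>, so differentiation at \<open>t = s\<close> yields \<open>D F\<^sub>i = \<Gamma>\<^sup>k\<^sub>i F\<^sub>k\<close>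
  (lemma \<open>frame_derivation_generates\<close>). On functions \<open>D\<close> is \<open>d/ds\<close>.

  Uniqueness: a derivation is determined by its values on functions and on the elements of one
  frame: inserting \<open>E\<^sub>i\<close> or an element of the dual frame into a field lowers its rank by one, and this
  insertion is a contraction of a tensor product, on which the axioms say how \<open>D\<close> acts (lemma \<open>derivation_unique\<close>). If the action on functions is not prescribed but the components
  are generated in every frame of class \<open>C\<^sup>1\<close>, the frames \<open>f E\<^sub>i\<close> with \<open>f\<close> free of zeros determine
  that action (lemma \<open>derivations_agree_on_functions\<close>).\<close>

section \<open>Bases and dual bases of a tangent space\<close>

lemma scaleR_fun_apply [simp]: "(a *\<^sub>R f) x = a *\<^sub>R f x"
  by (simp add: scaleR_fun_def)

lemma sum_fun_apply: "(\<Sum>i\<in>I. f i) x = (\<Sum>i\<in>I. f i x)"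
  by (induction I rule: infinite_finite_induct) auto

lemma sum_delta_mult [simp]:
  fixes f :: "'n::finite \<Rightarrow> real"
  shows "(\<Sum>k\<in>UNIV. f k * (if i = k then 1 else 0)) = f i"
    and "(\<Sum>k\<in>UNIV. f k * (if k = i then 1 else 0)) = f i"
    and "(\<Sum>k\<in>UNIV. (if i = k then 1 else 0) * f k) = f i"
    and "(\<Sum>k\<in>UNIV. (if k = i then 1 else 0) * f k) = f i"
  by (simp_all add: if_distrib[of "\<lambda>x. _ * x"] if_distrib[of "\<lambda>x. x * _"] cong: if_cong)

lemma real_linear_on_add:
  "real_linear_on V f \<Longrightarrow> v \<in> V \<Longrightarrow> w \<in> V \<Longrightarrow> f (v + w) = f v + f w"
  unfolding real_linear_on_def by (metis scaleR_one)

lemma real_linear_on_scale: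
  assumes "subspace V" "real_linear_on V f" "v \<in> V"
  shows "f (a *\<^sub>R v) = a *\<^sub>R f v"
proof -
  have "f (a *\<^sub>R v + 0 *\<^sub>R v) = a *\<^sub>R f v + 0 *\<^sub>R f v"
    using assms unfolding real_linear_on_def by blast
  then show ?thesis by simp
qed

lemma real_linear_on_sum:
  assumes "subspace V" "real_linear_on V f" "\<And>i. i \<in> I \<Longrightarrow> v i \<in> V"
  shows "f (\<Sum>i\<in>I. c i *\<^sub>R v i) = (\<Sum>i\<in>I. c i *\<^sub>R f (v i))"
proof -
  have zero: "f 0 = 0"
    using real_linear_on_scale[OF assms(1,2) subspace_0[OF assms(1)], of 0] by simp
  show ?thesis using assms(3)
  proof (induction I rule: infinite_finite_induct)
    case (insert i I)
    have "f (c i *\<^sub>R v i + (\<Sum>i\<in>I. c i *\<^sub>R v i)) = f (c i *\<^sub>R v i) + f (\<Sum>i\<in>I. c i *\<^sub>R v i)"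
      using insert.prems assms(1)
      by (intro real_linear_on_add[OF assms(2)] subspace_sum subspace_scale) auto
    then show ?case
      using insert real_linear_on_scale[OF assms(1,2)] by simp
  qed (simp_all add: zero)
qed

lemma subspace_tangent_space: "basis_at \<A> x e \<Longrightarrow> subspace (tangent_space \<A> x)"
  unfolding basis_at_def by (metis subspace_span)

lemma subspace_cotangent_space: "subspace (cotangent_space \<A> x)"
  unfolding subspace_def cotangent_space_def real_linear_on_def
  by (auto simp: algebra_simps)

lemma cotangent_space_linear:
  "\<omega> \<in> cotangent_space \<A> x \<Longrightarrow> real_linear_on (tangent_space \<A> x) \<omega>"
  by (simp add: cotangent_space_def)

lemma cotangent_space_outside: "\<omega> \<in> cotangent_space \<A> x \<Longrightarrow> v \<notin> tangent_space \<A> x \<Longrightarrow> \<omega> v = 0"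
  by (simp add: cotangent_space_def)

lemma basis_at_in: "basis_at \<A> x e \<Longrightarrow> e i \<in> tangent_space \<A> x"
  unfolding basis_at_def by (metis rangeI span_base)

lemma span_range_expansion:
  fixes e :: "'n::finite \<Rightarrow> 'a::real_vector"
  assumes "inj e" "v \<in> span (range e)"
  obtains c where "v = (\<Sum>i\<in>UNIV. c i *\<^sub>R e i)"
proof -
  obtain u where "v = (\<Sum>w\<in>range e. u w *\<^sub>R w)"
    using assms(2) by (auto simp: span_finite)
  then have "v = (\<Sum>i\<in>UNIV. u (e i) *\<^sub>R e i)"
    using assms(1) by (simp add: sum.reindex)
  then show thesis by (rule that)
qed

lemma
  assumes e: "basis_at \<A> x e"
  shows dual_basis_in: "dual_basis \<A> x e i \<in> cotangent_space \<A> x"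
    and dual_basis_basis: "dual_basis \<A> x e i (e j) = (if i = j then 1 else 0)"
proof -
  let ?r = "\<lambda>v. representation (range e) v (e i)"
  have inj: "inj e" and ind: "independent (range e)" and sp: "span (range e) = tangent_space \<A> x"
    using e by (auto simp: basis_at_def)
  have out: "v \<notin> tangent_space \<A> x \<Longrightarrow> ?r v = 0" for v
    by (simp add: representation_def sp)
  have T: "subspace (tangent_space \<A> x)" using e by (rule subspace_tangent_space)
  have r: "?r \<in> cotangent_space \<A> x"
    using ind T out unfolding cotangent_space_def real_linear_on_def
    by (auto simp: representation_add representation_scale sp subspace_scale)
  have rb: "?r (e j) = (if i = j then 1 else 0)" for j
    by (auto simp: representation_basis[OF ind rangeI] inj_eq[OF inj])
  have "dual_basis \<A> x e i = ?r"
    unfolding dual_basis_def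
  proof (rule the_equality)
    fix \<omega> assume \<omega>: "\<omega> \<in> cotangent_space \<A> x \<and> (\<forall>j. \<omega> (e j) = (if i = j then 1 else 0))"
    show "\<omega> = ?r"
    proof
      fix v
      show "\<omega> v = ?r v"
      proof (cases "v \<in> tangent_space \<A> x")
        case True
        with sp have "v \<in> span (range e)" by simp
        then obtain c where c: "v = (\<Sum>j\<in>UNIV. c j *\<^sub>R e j)"
          by (rule span_range_expansion[OF inj])
        have "\<eta> v = (\<Sum>j\<in>UNIV. c j * \<eta> (e j))" if "\<eta> \<in> cotangent_space \<A> x" for \<eta>
          using real_linear_on_sum[OF T cotangent_space_linear[OF that] basis_at_in[OF e]]
          by (simp add: c)
        from this[of \<omega>] this[OF r] show ?thesis using \<omega> rb by simp
      qed (use \<omega> out in \<open>simp add: cotangent_space_outside[of \<omega> \<A> x v]\<close>)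
    qed
  qed (use r rb in blast)
  then show "dual_basis \<A> x e i \<in> cotangent_space \<A> x"
    "dual_basis \<A> x e i (e j) = (if i = j then 1 else 0)"
    using r rb by simp_all
qed

lemma covector_sum:
  assumes "basis_at \<A> x e" "\<omega> \<in> cotangent_space \<A> x" "\<And>i. i \<in> I \<Longrightarrow> v i \<in> tangent_space \<A> x"
  shows "\<omega> (\<Sum>i\<in>I. c i *\<^sub>R v i) = (\<Sum>i\<in>I. c i * \<omega> (v i))"
  using real_linear_on_sum[OF subspace_tangent_space[OF assms(1)]
      cotangent_space_linear[OF assms(2)] assms(3)] by simp

lemma vector_expansion:
  assumes e: "basis_at \<A> x e" and v: "v \<in> tangent_space \<A> x"
  shows "v = (\<Sum>i\<in>UNIV. dual_basis \<A> x e i v *\<^sub>R e i)"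
proof -
  obtain c where c: "v = (\<Sum>j\<in>UNIV. c j *\<^sub>R e j)"
    using span_range_expansion[of e v] e v by (auto simp: basis_at_def)
  have "dual_basis \<A> x e i v = c i" for i
    unfolding c
    by (simp add: covector_sum[OF e dual_basis_in[OF e]] basis_at_in[OF e] dual_basis_basis[OF e])
  then show ?thesis using c by simp
qed

lemma covector_eqI:
  assumes e: "basis_at \<A> x e" and "\<omega> \<in> cotangent_space \<A> x" "\<eta> \<in> cotangent_space \<A> x"
    and "\<And>i. \<omega> (e i) = \<eta> (e i)"
  shows "\<omega> = \<eta>"
proof
  fix v
  show "\<omega> v = \<eta> v"
  proof (cases "v \<in> tangent_space \<A> x")
    case True
    then have v: "v = (\<Sum>i\<in>UNIV. dual_basis \<A> x e i v *\<^sub>R e i)" by (rule vector_expansion[OF e])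
    show ?thesis
      by (subst (1 2) v)
        (simp add: covector_sum[OF e assms(2)] covector_sum[OF e assms(3)] assms(4) basis_at_in[OF e])
  qed (simp add: cotangent_space_outside[OF assms(2)] cotangent_space_outside[OF assms(3)])
qed

text \<open>The dual basis spans the cotangent space because a covector is determined by its values on a
  basis.\<close>

lemma covector_expansion:
  assumes e: "basis_at \<A> x e" and \<omega>: "\<omega> \<in> cotangent_space \<A> x"
  shows "\<omega> = (\<Sum>i\<in>UNIV. \<omega> (e i) *\<^sub>R dual_basis \<A> x e i)"
proof (rule covector_eqI[OF e \<omega>])
  show "(\<Sum>i\<in>UNIV. \<omega> (e i) *\<^sub>R dual_basis \<A> x e i) \<in> cotangent_space \<A> x"
    by (intro subspace_sum subspace_scale subspace_cotangent_space dual_basis_in[OF e])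
qed (simp add: sum_fun_apply dual_basis_basis[OF e])

lemma tangent_space_combination:
  "basis_at \<A> x e \<Longrightarrow> (\<Sum>i\<in>UNIV. c i *\<^sub>R e i) \<in> tangent_space \<A> x"
  by (intro subspace_sum subspace_scale subspace_tangent_space basis_at_in) auto

lemma cotangent_space_combination:
  "basis_at \<A> x e \<Longrightarrow> (\<Sum>i\<in>UNIV. c i *\<^sub>R dual_basis \<A> x e i) \<in> cotangent_space \<A> x"
  by (intro subspace_sum subspace_scale subspace_cotangent_space dual_basis_in) auto

lemma dual_basis_combination:
  assumes e: "basis_at \<A> x e"
  shows "dual_basis \<A> x e i (\<Sum>j\<in>UNIV. c j *\<^sub>R e j) = c i"
  by (simp add: covector_sum[OF e dual_basis_in[OF e]] basis_at_in[OF e] dual_basis_basis[OF e])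

text \<open>If \<open>M\<close> and \<open>N\<close> are inverse to each other, the rows of \<open>N\<close> give covectors which are dual to
  the combinations \<open>g\<close> formed with the columns of \<open>M\<close>. The duality makes \<open>g\<close> linearly independent,
  and the inverse combinations recover \<open>e\<close>, so that \<open>g\<close> spans.\<close>

lemma basis_change:
  fixes M N :: "real ^ 'n ^ 'n::finite"
  assumes e: "basis_at \<A> x e" and MN: "M ** N = mat 1"
    and g: "\<And>j. g j = (\<Sum>i\<in>UNIV. (M $ i $ j) *\<^sub>R e i)"
  shows "basis_at \<A> x g"
    and "dual_basis \<A> x g j = (\<Sum>i\<in>UNIV. (N $ j $ i) *\<^sub>R dual_basis \<A> x e i)"
proof -
  let ?d = "\<lambda>j. \<Sum>i\<in>UNIV. (N $ j $ i) *\<^sub>R dual_basis \<A> x e i"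
  have NM: "N ** M = mat 1" using MN by (simp only: matrix_left_right_inverse[of M N])
  have gT: "g j \<in> tangent_space \<A> x" for j
    unfolding g using e by (rule tangent_space_combination)
  have T: "subspace (tangent_space \<A> x)" using e by (rule subspace_tangent_space)
  have dT: "?d j \<in> cotangent_space \<A> x" for j using e by (rule cotangent_space_combination)
  have dg: "?d k (g j) = (if k = j then 1 else 0)" for j k
  proof -
    have "?d k (g j) = (N ** M) $ k $ j"
      by (simp add: sum_fun_apply g dual_basis_combination[OF e] matrix_matrix_mult_def)
    then show ?thesis by (simp add: NM mat_def)
  qed
  have inj: "inj g"
  proof (rule injI)
    fix i j assume "g i = g j"
    then have "?d i (g i) = ?d i (g j)" by simp
    then show "i = j" unfolding dg by (simp split: if_splits)
  qed
  have eg: "e j = (\<Sum>i\<in>UNIV. (N $ i $ j) *\<^sub>R g i)" for j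
  proof -
    have "(\<Sum>i\<in>UNIV. (N $ i $ j) *\<^sub>R g i) = (\<Sum>k\<in>UNIV. ((M ** N) $ k $ j) *\<^sub>R e k)"
      unfolding g matrix_matrix_mult_def
      by (simp add: scaleR_sum_right scaleR_sum_left mult.commute[of "M $ _ $ _"]) (rule sum.swap)
    then show ?thesis
      by (simp add: MN mat_def if_distrib[of "\<lambda>x. x *\<^sub>R _"] cong: if_cong)
  qed
  have "independent (range g)"
  proof (rule independent_if_scalars_zero)
    fix f v assume 0: "(\<Sum>v\<in>range g. f v *\<^sub>R v) = 0" and "v \<in> range g"
    then obtain k where k: "v = g k" by blast
    have "0 = ?d k (\<Sum>i\<in>UNIV. f (g i) *\<^sub>R g i)"
      using 0 real_linear_on_scale[OF T cotangent_space_linear[OF dT] subspace_0[OF T], of k 0]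
      by (simp add: sum.reindex[OF inj])
    also have "\<dots> = f v"
      by (simp add: covector_sum[OF e dT] gT dg k)
    finally show "f v = 0" by simp
  qed simp
  moreover have "span (range g) = tangent_space \<A> x"
  proof
    show "span (range g) \<subseteq> tangent_space \<A> x" using gT T by (intro span_minimal) auto
    have "e j \<in> span (range g)" for j
      unfolding eg[of j] by (intro span_sum span_scale span_base) auto
    then have "span (range e) \<subseteq> span (range g)" by (intro span_minimal) auto
    then show "tangent_space \<A> x \<subseteq> span (range g)" using e by (simp add: basis_at_def)
  qed
  ultimately show "basis_at \<A> x g" using inj by (simp add: basis_at_def)
  note g_basis = this
  show "dual_basis \<A> x g j = ?d j"
    by (rule covector_eqI[OF g_basis dual_basis_in[OF g_basis] dT])
      (simp only: dg dual_basis_basis[OF g_basis])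
qed

section \<open>Tensors at a point\<close>

lemma tuples_append [simp]:
  "xs @ ys \<in> tuples V k \<longleftrightarrow> set xs \<subseteq> V \<and> set ys \<subseteq> V \<and> length xs + length ys = k"
  by (auto simp: tuples_def)

lemma tuples_Cons [simp]:
  "x # ys \<in> tuples V k \<longleftrightarrow> x \<in> V \<and> set ys \<subseteq> V \<and> Suc (length ys) = k"
  by (auto simp: tuples_def)

lemma tuples_Nil [simp]: "[] \<in> tuples V k \<longleftrightarrow> k = 0"
  by (auto simp: tuples_def)

lemma tuples_take_drop:
  assumes "take k xs \<in> tuples V k" "drop k xs \<in> tuples V l"
  shows "xs \<in> tuples V (k + l)"
proof -
  have "take k xs @ drop k xs \<in> tuples V (k + l)"
    using assms by (simp only: tuples_append) (simp add: tuples_def)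
  then show ?thesis by simp
qed

lemma tensor_outside:
  "A \<in> tensor_space \<A> x p q \<Longrightarrow>
     \<not> (\<omega>s \<in> tuples (cotangent_space \<A> x) p \<and> vs \<in> tuples (tangent_space \<A> x) q) \<Longrightarrow> A \<omega>s vs = 0"
  unfolding tensor_space_def by blast

lemma tensor_slots_linear:
  assumes "A \<in> tensor_space \<A> x p q"
    and "\<omega>s \<in> tuples (cotangent_space \<A> x) p" and "vs \<in> tuples (tangent_space \<A> x) q"
  shows "i < p \<Longrightarrow> real_linear_on (cotangent_space \<A> x) (\<lambda>\<omega>. A (\<omega>s[i := \<omega>]) vs)"
    and "j < q \<Longrightarrow> real_linear_on (tangent_space \<A> x) (\<lambda>v. A \<omega>s (vs[j := v]))"
  using assms unfolding tensor_space_def by blast+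

text \<open>Multilinearity is easier to establish and to use in the form \<open>xs @ \<omega> # ys\<close>, with a
  distinguished argument between the others, than with an updated list: taking an initial segment
  of the arguments and inserting further arguments both respect this form.\<close>

lemma tensor_spaceI:
  assumes "\<And>\<omega>s vs. A \<omega>s vs \<noteq> 0 \<Longrightarrow>
      \<omega>s \<in> tuples (cotangent_space \<A> x) p \<and> vs \<in> tuples (tangent_space \<A> x) q"
    and contra: "\<And>xs ys vs \<omega> \<eta> a b. \<lbrakk>set xs \<subseteq> cotangent_space \<A> x; set ys \<subseteq> cotangent_space \<A> x;
      p = Suc (length xs + length ys); vs \<in> tuples (tangent_space \<A> x) q;
      \<omega> \<in> cotangent_space \<A> x; \<eta> \<in> cotangent_space \<A> x\<rbrakk> \<Longrightarrow>
      A (xs @ (a *\<^sub>R \<omega> + b *\<^sub>R \<eta>) # ys) vs = a * A (xs @ \<omega> # ys) vs + b * A (xs @ \<eta> # ys) vs"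
    and co: "\<And>xs ys \<omega>s v w a b. \<lbrakk>set xs \<subseteq> tangent_space \<A> x; set ys \<subseteq> tangent_space \<A> x;
      q = Suc (length xs + length ys); \<omega>s \<in> tuples (cotangent_space \<A> x) p;
      v \<in> tangent_space \<A> x; w \<in> tangent_space \<A> x\<rbrakk> \<Longrightarrow>
      A \<omega>s (xs @ (a *\<^sub>R v + b *\<^sub>R w) # ys) = a * A \<omega>s (xs @ v # ys) + b * A \<omega>s (xs @ w # ys)"
  shows "A \<in> tensor_space \<A> x p q"
proof -
  have split: "xs[i := y] = take i xs @ y # drop (Suc i) xs"
    "set (take i xs) \<subseteq> V \<and> set (drop (Suc i) xs) \<subseteq> V"
    "k = Suc (length (take i xs) + length (drop (Suc i) xs))"
    if "xs \<in> tuples V k" "i < k" for xs :: "'c list" and i y V k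
    using that set_take_subset[of i xs] set_drop_subset[of "Suc i" xs]
    by (auto simp: tuples_def upd_conv_take_nth_drop)
  show ?thesis
    unfolding tensor_space_def
  proof (intro CollectI conjI ballI allI impI)
    fix \<omega>s vs i
    assume \<omega>s: "\<omega>s \<in> tuples (cotangent_space \<A> x) p" and vs: "vs \<in> tuples (tangent_space \<A> x) q"
      and i: "i < p"
    show "real_linear_on (cotangent_space \<A> x) (\<lambda>\<omega>. A (\<omega>s[i := \<omega>]) vs)"
      unfolding real_linear_on_def split(1)[OF \<omega>s i]
      using split(2,3)[OF \<omega>s i] vs contra by simp
  next
    fix \<omega>s vs i
    assume \<omega>s: "\<omega>s \<in> tuples (cotangent_space \<A> x) p" and vs: "vs \<in> tuples (tangent_space \<A> x) q"
      and i: "i < q"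
    show "real_linear_on (tangent_space \<A> x) (\<lambda>v. A \<omega>s (vs[i := v]))"
      unfolding real_linear_on_def split(1)[OF vs i]
      using split(2,3)[OF vs i] \<omega>s co by simp
  qed (use assms(1) in blast)
qed

text \<open>Lists of wrong length or with entries outside the space are harmless, since a tensor
  vanishes there.\<close>

lemma tensor_contra_linear:
  assumes A: "A \<in> tensor_space \<A> x p q"
  shows "real_linear_on (cotangent_space \<A> x) (\<lambda>\<omega>. A (xs @ \<omega> # ys) vs)"
proof (cases "set xs \<subseteq> cotangent_space \<A> x \<and> set ys \<subseteq> cotangent_space \<A> x \<and>
    p = Suc (length xs + length ys) \<and> vs \<in> tuples (tangent_space \<A> x) q")
  case True
  have "xs @ 0 # ys \<in> tuples (cotangent_space \<A> x) p"
    using True subspace_0[OF subspace_cotangent_space] by auto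
  then have "real_linear_on (cotangent_space \<A> x) (\<lambda>\<omega>. A ((xs @ 0 # ys)[length xs := \<omega>]) vs)"
    using True by (intro tensor_slots_linear(1)[OF A]) auto
  then show ?thesis by simp
next
  case False
  then have "A (xs @ \<omega> # ys) vs = 0" for \<omega>
    by (intro tensor_outside[OF A]) auto
  then show ?thesis by (simp add: real_linear_on_def)
qed

lemma tensor_co_linear:
  assumes A: "A \<in> tensor_space \<A> x p q" and T: "subspace (tangent_space \<A> x)"
  shows "real_linear_on (tangent_space \<A> x) (\<lambda>v. A \<omega>s (xs @ v # ys))"
proof (cases "set xs \<subseteq> tangent_space \<A> x \<and> set ys \<subseteq> tangent_space \<A> x \<and>
    q = Suc (length xs + length ys) \<and> \<omega>s \<in> tuples (cotangent_space \<A> x) p")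
  case True
  have "xs @ 0 # ys \<in> tuples (tangent_space \<A> x) q"
    using True subspace_0[OF T] by auto
  then have "real_linear_on (tangent_space \<A> x) (\<lambda>v. A \<omega>s ((xs @ 0 # ys)[length xs := v]))"
    using True by (intro tensor_slots_linear(2)[OF A]) auto
  then show ?thesis by simp
next
  case False
  then have "A \<omega>s (xs @ v # ys) = 0" for v
    by (intro tensor_outside[OF A]) auto
  then show ?thesis by (simp add: real_linear_on_def)
qed

lemma tensor_contra_sum:
  assumes "A \<in> tensor_space \<A> x p q" "\<And>k. w k \<in> cotangent_space \<A> x"
  shows "A (xs @ (\<Sum>k\<in>I. c k *\<^sub>R w k) # ys) vs = (\<Sum>k\<in>I. c k * A (xs @ w k # ys) vs)"
  using real_linear_on_sum[OF subspace_cotangent_space tensor_contra_linear[OF assms(1)] assms(2)]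
  by simp

lemma tensor_co_sum:
  assumes "A \<in> tensor_space \<A> x p q" "subspace (tangent_space \<A> x)" "\<And>k. w k \<in> tangent_space \<A> x"
  shows "A \<omega>s (xs @ (\<Sum>k\<in>I. c k *\<^sub>R w k) # ys) = (\<Sum>k\<in>I. c k * A \<omega>s (xs @ w k # ys))"
  using real_linear_on_sum[OF assms(2) tensor_co_linear[OF assms(1,2)] assms(3)] by simp

text \<open>Because only the first argument is expanded, equality of tensors can be proved by induction on
  their type, without multi-indices.\<close>

lemma tensor_eqI_contra:
  assumes e: "basis_at \<A> x e"
    and A: "A \<in> tensor_space \<A> x (Suc p) q" and B: "B \<in> tensor_space \<A> x (Suc p) q"
    and eq: "\<And>i \<omega>s vs. A (dual_basis \<A> x e i # \<omega>s) vs = B (dual_basis \<A> x e i # \<omega>s) vs"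
  shows "A = B"
proof (intro ext)
  fix \<omega>s vs
  show "A \<omega>s vs = B \<omega>s vs"
  proof (cases "\<omega>s \<in> tuples (cotangent_space \<A> x) (Suc p)")
    case True
    then obtain \<omega> \<eta>s where \<omega>s: "\<omega>s = \<omega> # \<eta>s" and \<omega>: "\<omega> \<in> cotangent_space \<A> x"
      by (cases \<omega>s) (auto simp: tuples_def)
    show ?thesis
      unfolding \<omega>s
      using tensor_contra_sum[where xs = "[]" and I = UNIV and w = "dual_basis \<A> x e"
          and c = "\<lambda>i. \<omega> (e i)", OF A dual_basis_in[OF e]]
        tensor_contra_sum[where xs = "[]" and I = UNIV and w = "dual_basis \<A> x e"
          and c = "\<lambda>i. \<omega> (e i)", OF B dual_basis_in[OF e]]
      by (simp add: eq covector_expansion[OF e \<omega>, symmetric])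
  next
    case False
    then show ?thesis using tensor_outside[OF A] tensor_outside[OF B] by metis
  qed
qed

lemma tensor_eqI_co:
  assumes e: "basis_at \<A> x e"
    and A: "A \<in> tensor_space \<A> x p (Suc q)" and B: "B \<in> tensor_space \<A> x p (Suc q)"
    and eq: "\<And>i \<omega>s vs. A \<omega>s (e i # vs) = B \<omega>s (e i # vs)"
  shows "A = B"
proof (intro ext)
  fix \<omega>s vs
  note T = subspace_tangent_space[OF e]
  show "A \<omega>s vs = B \<omega>s vs"
  proof (cases "vs \<in> tuples (tangent_space \<A> x) (Suc q)")
    case True
    then obtain v ws where vs: "vs = v # ws" and v: "v \<in> tangent_space \<A> x"
      by (cases vs) (auto simp: tuples_def)
    show ?thesis
      unfolding vs
      using tensor_co_sum[where xs = "[]" and I = UNIV and w = e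
          and c = "\<lambda>i. dual_basis \<A> x e i v", OF A T basis_at_in[OF e]]
        tensor_co_sum[where xs = "[]" and I = UNIV and w = e
          and c = "\<lambda>i. dual_basis \<A> x e i v", OF B T basis_at_in[OF e]]
      by (simp add: eq vector_expansion[OF e v, symmetric])
  next
    case False
    then show ?thesis using tensor_outside[OF A] tensor_outside[OF B] by metis
  qed
qed

lemma tensor_prod_in:
  assumes A: "A \<in> tensor_space \<A> x p q" and B: "B \<in> tensor_space \<A> x p' q'"
    and T: "subspace (tangent_space \<A> x)"
  shows "tensor_prod p q A B \<in> tensor_space \<A> x (p + p') (q + q')"
proof (rule tensor_spaceI)
  fix \<omega>s vs assume "tensor_prod p q A B \<omega>s vs \<noteq> 0"
  then have "A (take p \<omega>s) (take q vs) \<noteq> 0" "B (drop p \<omega>s) (drop q vs) \<noteq> 0"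
    by (auto simp: tensor_prod_def)
  then have "take p \<omega>s \<in> tuples (cotangent_space \<A> x) p" "take q vs \<in> tuples (tangent_space \<A> x) q"
    "drop p \<omega>s \<in> tuples (cotangent_space \<A> x) p'" "drop q vs \<in> tuples (tangent_space \<A> x) q'"
    using tensor_outside[OF A] tensor_outside[OF B] by blast+
  then show "\<omega>s \<in> tuples (cotangent_space \<A> x) (p + p') \<and> vs \<in> tuples (tangent_space \<A> x) (q + q')"
    by (blast intro: tuples_take_drop)
next
  fix xs ys :: "('a,'b) covec list" and vs and \<omega> \<eta> :: "('a,'b) covec" and a b :: real
  assume *: "\<omega> \<in> cotangent_space \<A> x" "\<eta> \<in> cotangent_space \<A> x"
  show "tensor_prod p q A B (xs @ (a *\<^sub>R \<omega> + b *\<^sub>R \<eta>) # ys) vs =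
     a * tensor_prod p q A B (xs @ \<omega> # ys) vs + b * tensor_prod p q A B (xs @ \<eta> # ys) vs"
  proof (cases "p \<le> length xs")
    case True
    then show ?thesis
      using tensor_contra_linear[OF B, of "drop p xs" ys "drop q vs"] *
      by (simp add: tensor_prod_def real_linear_on_def algebra_simps)
  next
    case False
    then obtain d where "p - length xs = Suc d" by (metis Suc_diff_Suc not_le)
    then show ?thesis
      using False tensor_contra_linear[OF A, of xs "take d ys" "take q vs"] *
      by (simp add: tensor_prod_def real_linear_on_def algebra_simps)
  qed
next
  fix xs ys :: "('a,'b) tvec list" and \<omega>s and v w :: "('a,'b) tvec" and a b :: real
  assume *: "v \<in> tangent_space \<A> x" "w \<in> tangent_space \<A> x"
  show "tensor_prod p q A B \<omega>s (xs @ (a *\<^sub>R v + b *\<^sub>R w) # ys) =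
     a * tensor_prod p q A B \<omega>s (xs @ v # ys) + b * tensor_prod p q A B \<omega>s (xs @ w # ys)"
  proof (cases "q \<le> length xs")
    case True
    then show ?thesis
      using tensor_co_linear[OF B T, of "drop p \<omega>s" "drop q xs" ys] *
      by (simp add: tensor_prod_def real_linear_on_def algebra_simps)
  next
    case False
    then obtain d where "q - length xs = Suc d" by (metis Suc_diff_Suc not_le)
    then show ?thesis
      using False tensor_co_linear[OF A T, of "take p \<omega>s" xs "take d ys"] *
      by (simp add: tensor_prod_def real_linear_on_def algebra_simps)
  qed
qed

lemma insert_at_append:
  "insert_at i w (xs @ y # ys) =
     (if i \<le> length xs then insert_at i w xs @ y # ys
      else xs @ y # insert_at (i - Suc (length xs)) w ys)"
proof (cases "i \<le> length xs")
  case False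
  then obtain d where "i = Suc (length xs + d)" by (auto simp: not_le less_iff_Suc_add)
  then show ?thesis by (simp add: insert_at_def)
qed (simp add: insert_at_def)

lemma set_insert_at [simp]: "set (insert_at i w xs) = insert w (set xs)"
  unfolding insert_at_def by (metis append_take_drop_id list.simps(15) set_append Un_insert_right)

lemma length_insert_at [simp]: "length (insert_at i w xs) = Suc (length xs)"
  by (simp add: insert_at_def)

lemma map_insert_at: "map f (insert_at i w xs) = insert_at i (f w) (map f xs)"
  by (simp add: insert_at_def take_map drop_map)

text \<open>The components of one basis in another one and those of the corresponding dual bases form
  inverse matrices, which cancel in the trace of a bilinear form.\<close>

lemma trace_basis_independent:
  assumes e: "basis_at \<A> x e" and g: "basis_at \<A> x g"
    and contra: "\<And>c v. f (\<Sum>m\<in>UNIV. c m *\<^sub>R dual_basis \<A> x e m) v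
                   = (\<Sum>m\<in>UNIV. c m * f (dual_basis \<A> x e m) v)"
    and co: "\<And>c \<omega>. f \<omega> (\<Sum>l\<in>UNIV. c l *\<^sub>R e l) = (\<Sum>l\<in>UNIV. c l * (f \<omega> (e l) :: real))"
  shows "(\<Sum>k\<in>UNIV. f (dual_basis \<A> x g k) (g k)) = (\<Sum>k\<in>UNIV. f (dual_basis \<A> x e k) (e k))"
proof -
  let ?e = "dual_basis \<A> x e" and ?g = "dual_basis \<A> x g"
  have expand: "f (?g k) (g k) = (\<Sum>m\<in>UNIV. \<Sum>l\<in>UNIV. ?g k (e m) * ?e l (g k) * f (?e m) (e l))" for k
  proof -
    have "f (?g k) (g k) = (\<Sum>m\<in>UNIV. ?g k (e m) * f (?e m) (g k))"
      using contra[of "\<lambda>m. ?g k (e m)" "g k"] covector_expansion[OF e dual_basis_in[OF g], of k]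
      by simp
    moreover have "f (?e m) (g k) = (\<Sum>l\<in>UNIV. ?e l (g k) * f (?e m) (e l))" for m
      using co[of "?e m" "\<lambda>l. ?e l (g k)"] vector_expansion[OF e basis_at_in[OF g], of k] by simp
    ultimately show ?thesis by (simp add: sum_distrib_left mult.assoc)
  qed
  have inverse: "(\<Sum>k\<in>UNIV. ?g k (e m) * ?e l (g k)) = (if l = m then 1 else 0)" for m l
  proof -
    have "?e l (\<Sum>k\<in>UNIV. ?g k (e m) *\<^sub>R g k) = (\<Sum>k\<in>UNIV. ?g k (e m) * ?e l (g k))"
      by (intro covector_sum[OF g dual_basis_in[OF e]] basis_at_in[OF g])
    then show ?thesis
      using vector_expansion[OF g basis_at_in[OF e], of m] by (simp add: dual_basis_basis[OF e])
  qed
  have "(\<Sum>k\<in>UNIV. f (?g k) (g k))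
      = (\<Sum>m\<in>UNIV. \<Sum>l\<in>UNIV. \<Sum>k\<in>UNIV. ?g k (e m) * ?e l (g k) * f (?e m) (e l))"
    unfolding expand by (subst sum.swap) (intro sum.cong refl sum.swap)
  also have "\<dots> = (\<Sum>m\<in>UNIV. \<Sum>l\<in>UNIV. (\<Sum>k\<in>UNIV. ?g k (e m) * ?e l (g k)) * f (?e m) (e l))"
    by (simp add: sum_distrib_right)
  finally show ?thesis unfolding inverse by simp
qed

lemma contract_basis:
  assumes e: "basis_at \<A> x e" and A: "A \<in> tensor_space \<A> x p q"
  shows "contract \<A> x i j A \<omega>s vs =
     (\<Sum>k\<in>UNIV. A (insert_at i (dual_basis \<A> x e k) \<omega>s) (insert_at j (e k) vs))"
proof -
  let ?g = "SOME g. basis_at \<A> x g"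
  have g: "basis_at \<A> x ?g" by (rule someI[where P = "basis_at \<A> x", OF e])
  have "(\<Sum>k\<in>UNIV. A (insert_at i (dual_basis \<A> x ?g k) \<omega>s) (insert_at j (?g k) vs)) =
     (\<Sum>k\<in>UNIV. A (insert_at i (dual_basis \<A> x e k) \<omega>s) (insert_at j (e k) vs))"
  proof (rule trace_basis_independent[OF e g, of "\<lambda>\<omega> v. A (insert_at i \<omega> \<omega>s) (insert_at j v vs)"])
  qed (simp_all add: insert_at_def tensor_contra_sum[OF A dual_basis_in[OF e]]
         tensor_co_sum[OF A subspace_tangent_space[OF e] basis_at_in[OF e]])
  then show ?thesis by (simp add: contract_def Let_def)
qed

lemma contract_in:
  assumes e: "basis_at \<A> x e" and A: "A \<in> tensor_space \<A> x (Suc p) (Suc q)"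
  shows "contract \<A> x i j A \<in> tensor_space \<A> x p q"
proof (rule tensor_spaceI)
  note C = contract_basis[OF e A]
  fix \<omega>s vs assume "contract \<A> x i j A \<omega>s vs \<noteq> 0"
  then obtain k where "A (insert_at i (dual_basis \<A> x e k) \<omega>s) (insert_at j (e k) vs) \<noteq> 0"
    unfolding C by (metis (no_types, lifting) sum.neutral)
  then show "\<omega>s \<in> tuples (cotangent_space \<A> x) p \<and> vs \<in> tuples (tangent_space \<A> x) q"
    using tensor_outside[OF A, of "insert_at i (dual_basis \<A> x e k) \<omega>s" "insert_at j (e k) vs"]
    by (auto simp: tuples_def)
next
  note C = contract_basis[OF e A]
  fix xs ys :: "('a,'b) covec list" and vs and \<omega> \<eta> :: "('a,'b) covec" and a b :: real
  assume *: "\<omega> \<in> cotangent_space \<A> x" "\<eta> \<in> cotangent_space \<A> x"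
  have "A (insert_at i \<theta> (xs @ (a *\<^sub>R \<omega> + b *\<^sub>R \<eta>) # ys)) ws =
     a * A (insert_at i \<theta> (xs @ \<omega> # ys)) ws + b * A (insert_at i \<theta> (xs @ \<eta> # ys)) ws" for \<theta> ws
    using tensor_contra_linear[OF A] * by (simp add: insert_at_append real_linear_on_def)
  then show "contract \<A> x i j A (xs @ (a *\<^sub>R \<omega> + b *\<^sub>R \<eta>) # ys) vs =
     a * contract \<A> x i j A (xs @ \<omega> # ys) vs + b * contract \<A> x i j A (xs @ \<eta> # ys) vs"
    unfolding C by (simp add: sum.distrib sum_distrib_left)
next
  note C = contract_basis[OF e A] and T = subspace_tangent_space[OF e]
  fix xs ys :: "('a,'b) tvec list" and \<omega>s and v w :: "('a,'b) tvec" and a b :: real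
  assume *: "v \<in> tangent_space \<A> x" "w \<in> tangent_space \<A> x"
  have "A \<eta>s (insert_at j u (xs @ (a *\<^sub>R v + b *\<^sub>R w) # ys)) =
     a * A \<eta>s (insert_at j u (xs @ v # ys)) + b * A \<eta>s (insert_at j u (xs @ w # ys))" for \<eta>s u
    using tensor_co_linear[OF A T] * by (simp add: insert_at_append real_linear_on_def)
  then show "contract \<A> x i j A \<omega>s (xs @ (a *\<^sub>R v + b *\<^sub>R w) # ys) =
     a * contract \<A> x i j A \<omega>s (xs @ v # ys) + b * contract \<A> x i j A \<omega>s (xs @ w # ys)"
    unfolding C by (simp add: sum.distrib sum_distrib_left)
qed

lemma subspace_tensor_space: "subspace (tensor_space \<A> x p q)"
  unfolding subspace_def tensor_space_def real_linear_on_def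
  by (auto simp: algebra_simps)

text \<open>The counterpart of \<^const>\<open>vector_tensor\<close> for the type \<open>(0,1)\<close>.\<close>

definition covector_tensor ::
  "('m, 'n::finite) chart set \<Rightarrow> 'm \<Rightarrow> ('m, 'n) covec \<Rightarrow> ('m, 'n) tensor" where
  "covector_tensor \<A> x \<omega> =
     (\<lambda>\<omega>s vs. if \<omega>s = [] \<and> vs \<in> tuples (tangent_space \<A> x) 1 then \<omega> (hd vs) else 0)"

lemma covector_tensor_in:
  assumes "\<omega> \<in> cotangent_space \<A> x" and T: "subspace (tangent_space \<A> x)"
  shows "covector_tensor \<A> x \<omega> \<in> tensor_space \<A> x 0 1"
proof (rule tensor_spaceI)
  fix xs ys :: "('a,'b) tvec list" and \<omega>s :: "('a,'b) covec list"
    and v w :: "('a,'b) tvec" and a b :: real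
  assume "1 = Suc (length xs + length ys)" "\<omega>s \<in> tuples (cotangent_space \<A> x) 0"
    and vw: "v \<in> tangent_space \<A> x" "w \<in> tangent_space \<A> x"
  then have [simp]: "xs = []" "ys = []" "\<omega>s = []" by (auto simp: tuples_def)
  have "a *\<^sub>R v + b *\<^sub>R w \<in> tangent_space \<A> x"
    using vw T by (simp add: subspace_add subspace_scale)
  then show "covector_tensor \<A> x \<omega> \<omega>s (xs @ (a *\<^sub>R v + b *\<^sub>R w) # ys) =
     a * covector_tensor \<A> x \<omega> \<omega>s (xs @ v # ys) + b * covector_tensor \<A> x \<omega> \<omega>s (xs @ w # ys)"
    using cotangent_space_linear[OF assms(1)] vw
    by (simp add: covector_tensor_def real_linear_on_def)
qed (auto simp: covector_tensor_def split: if_splits)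

lemma vector_tensor_in: "vector_tensor \<A> x v \<in> tensor_space \<A> x 1 0"
proof (rule tensor_spaceI)
  fix xs ys :: "('a,'b) covec list" and vs :: "('a,'b) tvec list"
    and \<omega> \<eta> :: "('a,'b) covec" and a b :: real
  assume "1 = Suc (length xs + length ys)" "vs \<in> tuples (tangent_space \<A> x) 0"
    and \<omega>\<eta>: "\<omega> \<in> cotangent_space \<A> x" "\<eta> \<in> cotangent_space \<A> x"
  then have [simp]: "xs = []" "ys = []" "vs = []" by (auto simp: tuples_def)
  have "a *\<^sub>R \<omega> + b *\<^sub>R \<eta> \<in> cotangent_space \<A> x"
    using \<omega>\<eta> by (intro subspace_add subspace_scale subspace_cotangent_space)
  then show "vector_tensor \<A> x v (xs @ (a *\<^sub>R \<omega> + b *\<^sub>R \<eta>) # ys) vs =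
     a * vector_tensor \<A> x v (xs @ \<omega> # ys) vs + b * vector_tensor \<A> x v (xs @ \<eta> # ys) vs"
    using \<omega>\<eta> by (simp add: vector_tensor_def)
qed (auto simp: vector_tensor_def split: if_splits)

lemma vector_tensor_apply: "\<omega> \<in> cotangent_space \<A> x \<Longrightarrow> vector_tensor \<A> x v [\<omega>] [] = \<omega> v"
  by (simp add: vector_tensor_def)

lemma scalar_tensor_in: "scalar_tensor r \<in> tensor_space \<A> x 0 0"
  by (rule tensor_spaceI) (auto simp: scalar_tensor_def split: if_splits)

lemma tensor_10_eqI:
  assumes A: "A \<in> tensor_space \<A> x 1 0" and B: "B \<in> tensor_space \<A> x 1 0"
    and eq: "\<And>\<omega>. \<omega> \<in> cotangent_space \<A> x \<Longrightarrow> A [\<omega>] [] = B [\<omega>] []"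
  shows "A = B"
proof (intro ext)
  fix \<omega>s vs
  show "A \<omega>s vs = B \<omega>s vs"
  proof (cases "\<omega>s \<in> tuples (cotangent_space \<A> x) 1 \<and> vs = []")
    case True
    then obtain \<omega> where "\<omega>s = [\<omega>]" "\<omega> \<in> cotangent_space \<A> x"
      by (cases \<omega>s) (auto simp: tuples_def)
    with True eq show ?thesis by simp
  next
    case False
    then have "\<not> (\<omega>s \<in> tuples (cotangent_space \<A> x) 1 \<and> vs \<in> tuples (tangent_space \<A> x) 0)"
      by (auto simp: tuples_def)
    then show ?thesis using tensor_outside[OF A] tensor_outside[OF B] by metis
  qed
qed

lemma vector_tensor_sum:
  assumes e: "basis_at \<A> x e" and v: "\<And>k. v k \<in> tangent_space \<A> x"
  shows "vector_tensor \<A> x (\<Sum>k\<in>UNIV. c k *\<^sub>R v k) = (\<Sum>k\<in>UNIV. c k *\<^sub>R vector_tensor \<A> x (v k))"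
proof (rule tensor_10_eqI[where \<A> = \<A> and x = x])
  fix \<omega> assume \<omega>: "\<omega> \<in> cotangent_space \<A> x"
  show "vector_tensor \<A> x (\<Sum>k\<in>UNIV. c k *\<^sub>R v k) [\<omega>] []
      = (\<Sum>k\<in>UNIV. c k *\<^sub>R vector_tensor \<A> x (v k)) [\<omega>] []"
    by (simp add: sum_fun_apply vector_tensor_apply[OF \<omega>] covector_sum[OF e \<omega> v])
qed (intro vector_tensor_in subspace_sum subspace_scale subspace_tensor_space)+

text \<open>A tensor of type \<open>(1,0)\<close> is a linear form on covectors, so it is determined by its values on
  the dual basis: a finite-dimensional space is its own double dual.\<close>

lemma tensor_10_expansion:
  assumes e: "basis_at \<A> x e" and A: "A \<in> tensor_space \<A> x 1 0"
  shows "A = (\<Sum>k\<in>UNIV. A [dual_basis \<A> x e k] [] *\<^sub>R vector_tensor \<A> x (e k))"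
proof (rule tensor_10_eqI[OF A])
  fix \<omega> assume \<omega>: "\<omega> \<in> cotangent_space \<A> x"
  have "A [\<omega>] [] = (\<Sum>k\<in>UNIV. \<omega> (e k) * A [dual_basis \<A> x e k] [])"
    using tensor_contra_sum[where xs = "[]" and ys = "[]" and I = UNIV and w = "dual_basis \<A> x e"
        and c = "\<lambda>i. \<omega> (e i)", OF A dual_basis_in[OF e]]
    by (simp add: covector_expansion[OF e \<omega>, symmetric])
  then show "A [\<omega>] [] = (\<Sum>k\<in>UNIV. A [dual_basis \<A> x e k] [] *\<^sub>R vector_tensor \<A> x (e k)) [\<omega>] []"
    by (simp add: sum_fun_apply vector_tensor_apply[OF \<omega>] mult.commute)
qed (intro subspace_sum subspace_scale subspace_tensor_space vector_tensor_in)

text \<open>Inserting a vector into a tensor is a tensor product followed by a contraction. This gives the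
  axioms of a derivation access to the values of a field on given arguments.\<close>

lemma contract_with_vector:
  assumes e: "basis_at \<A> x e" and A: "A \<in> tensor_space \<A> x p (Suc q)"
    and v: "v \<in> tangent_space \<A> x"
    and "length \<omega>s = p" "length vs = q"
  shows "contract \<A> x p 0 (tensor_prod p (Suc q) A (vector_tensor \<A> x v)) \<omega>s vs = A \<omega>s (v # vs)"
proof -
  have AB: "tensor_prod p (Suc q) A (vector_tensor \<A> x v) \<in> tensor_space \<A> x (p + 1) (Suc q + 0)"
    by (intro tensor_prod_in A vector_tensor_in subspace_tangent_space[OF e])
  have "A \<omega>s (v # vs) = (\<Sum>k\<in>UNIV. dual_basis \<A> x e k v * A \<omega>s (e k # vs))"
    using tensor_co_sum[where xs = "[]" and ys = vs and I = UNIV and w = e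
          and c = "\<lambda>i. dual_basis \<A> x e i v", OF A subspace_tangent_space[OF e] basis_at_in[OF e]]
    by (simp add: vector_expansion[OF e v, symmetric])
  then show ?thesis
    unfolding contract_basis[OF e AB]
    by (simp add: insert_at_def tensor_prod_def assms(4,5)
          vector_tensor_apply[OF dual_basis_in[OF e]] mult.commute)
qed

lemma contract_with_covector:
  assumes e: "basis_at \<A> x e" and A: "A \<in> tensor_space \<A> x (Suc p) q"
    and \<omega>: "\<omega> \<in> cotangent_space \<A> x"
    and "length \<omega>s = p" "length vs = q"
  shows "contract \<A> x 0 q (tensor_prod (Suc p) q A (covector_tensor \<A> x \<omega>)) \<omega>s vs = A (\<omega> # \<omega>s) vs"
proof -
  have AB: "tensor_prod (Suc p) q A (covector_tensor \<A> x \<omega>) \<in> tensor_space \<A> x (Suc p + 0) (q + 1)"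
    by (intro tensor_prod_in A covector_tensor_in[OF \<omega>] subspace_tangent_space[OF e])
  have "A (\<omega> # \<omega>s) vs = (\<Sum>k\<in>UNIV. \<omega> (e k) * A (dual_basis \<A> x e k # \<omega>s) vs)"
    using tensor_contra_sum[where xs = "[]" and ys = \<omega>s and I = UNIV and w = "dual_basis \<A> x e"
        and c = "\<lambda>i. \<omega> (e i)", OF A dual_basis_in[OF e]]
    by (simp add: covector_expansion[OF e \<omega>, symmetric])
  moreover have "covector_tensor \<A> x \<omega> [] [e k] = \<omega> (e k)" for k
    by (simp add: covector_tensor_def basis_at_in[OF e])
  ultimately show ?thesis
    unfolding contract_basis[OF e AB]
    by (simp add: insert_at_def tensor_prod_def assms(4,5) mult.commute)
qed

section \<open>Functions of class \<open>C\<^sup>1\<close> on an interval\<close>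

lemma C1_on_cong:
  assumes "C1_on J f" "\<And>s. s \<in> J \<Longrightarrow> g s = f s"
  shows "C1_on J g"
  using assms unfolding C1_on_def by (metis has_vector_derivative_transform)

lemma C1_on_has_derivative:
  assumes "C1_on J f" "s \<in> J"
  shows "(f has_vector_derivative vector_derivative f (at s within J)) (at s within J)"
  using assms unfolding C1_on_def
  by (metis differentiableI_vector vector_derivative_works)

lemma C1_on_continuous:
  fixes f :: "real \<Rightarrow> real"
  assumes "C1_on J f"
  shows "continuous_on J f"
  using assms unfolding C1_on_def
  by (meson continuous_on_eq_continuous_within has_vector_derivative_continuous)

lemma C1_on_const [simp]: "C1_on J (\<lambda>s. c)"
  unfolding C1_on_def by (rule exI[of _ "\<lambda>s. 0"]) auto

lemma C1_on_add:
  fixes f g :: "real \<Rightarrow> real"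
  assumes "C1_on J f" "C1_on J g"
  shows "C1_on J (\<lambda>s. f s + g s)"
proof -
  obtain f' g' where "\<forall>s\<in>J. (f has_vector_derivative f' s) (at s within J)" "continuous_on J f'"
    "\<forall>s\<in>J. (g has_vector_derivative g' s) (at s within J)" "continuous_on J g'"
    using assms unfolding C1_on_def by blast
  then show ?thesis
    unfolding C1_on_def
    by (intro exI[of _ "\<lambda>s. f' s + g' s"])
       (auto intro: has_vector_derivative_add continuous_on_add)
qed

lemma C1_on_mult:
  fixes f g :: "real \<Rightarrow> real"
  assumes "C1_on J f" "C1_on J g"
  shows "C1_on J (\<lambda>s. f s * g s)"
proof -
  obtain f' g' where f': "\<forall>s\<in>J. (f has_vector_derivative f' s) (at s within J)" "continuous_on J f'"
    and g': "\<forall>s\<in>J. (g has_vector_derivative g' s) (at s within J)" "continuous_on J g'"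
    using assms unfolding C1_on_def by blast
  have "\<forall>s\<in>J. ((\<lambda>s. f s * g s) has_vector_derivative f s * g' s + f' s * g s) (at s within J)"
    using f' g' by (auto intro: has_vector_derivative_mult)
  moreover have "continuous_on J (\<lambda>s. f s * g' s + f' s * g s)"
    by (intro continuous_on_add continuous_on_mult C1_on_continuous assms f' g')
  ultimately show ?thesis unfolding C1_on_def by (intro exI conjI) auto
qed

lemma C1_on_inverse:
  fixes f :: "real \<Rightarrow> real"
  assumes "C1_on J f" and nz: "\<And>s. s \<in> J \<Longrightarrow> f s \<noteq> 0"
  shows "C1_on J (\<lambda>s. inverse (f s))"
proof -
  obtain f' where f': "\<forall>s\<in>J. (f has_vector_derivative f' s) (at s within J)" "continuous_on J f'"
    using assms unfolding C1_on_def by blast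
  have "((\<lambda>s. inverse (f s)) has_vector_derivative - (inverse (f s) * f' s * inverse (f s)))
      (at s within J)" if "s \<in> J" for s
    using f'(1) that nz DERIV_inverse'[of f "f' s" s J]
    by (simp add: has_real_derivative_iff_has_vector_derivative)
  moreover have "continuous_on J (\<lambda>s. - (inverse (f s) * f' s * inverse (f s)))"
    using nz by (intro continuous_intros C1_on_continuous assms f') auto
  ultimately show ?thesis unfolding C1_on_def by (intro exI conjI) auto
qed

lemma C1_on_sum:
  fixes f :: "'i \<Rightarrow> real \<Rightarrow> real"
  shows "(\<And>i. i \<in> I \<Longrightarrow> C1_on J (f i)) \<Longrightarrow> C1_on J (\<lambda>s. \<Sum>i\<in>I. f i s)"
  by (induction I rule: infinite_finite_induct) (auto intro: C1_on_add)

lemma C1_on_prod: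
  fixes f :: "'i \<Rightarrow> real \<Rightarrow> real"
  shows "(\<And>i. i \<in> I \<Longrightarrow> C1_on J (f i)) \<Longrightarrow> C1_on J (\<lambda>s. \<Prod>i\<in>I. f i s)"
  by (induction I rule: infinite_finite_induct) (auto intro: C1_on_mult)

lemma C1_on_entry:
  fixes M :: "real \<Rightarrow> real ^ 'n ^ 'm"
  assumes "C1_on J M"
  shows "C1_on J (\<lambda>s. M s $ i $ j)"
proof -
  obtain M' where M': "\<forall>s\<in>J. (M has_vector_derivative M' s) (at s within J)" "continuous_on J M'"
    using assms unfolding C1_on_def by blast
  have "\<forall>s\<in>J. ((\<lambda>s. M s $ i $ j) has_vector_derivative M' s $ i $ j) (at s within J)"
    using M' by (auto intro!: bounded_linear.has_vector_derivative[OF bounded_linear_vec_nth])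
  moreover have "continuous_on J (\<lambda>s. M' s $ i $ j)"
    by (intro continuous_on_component M')
  ultimately show ?thesis unfolding C1_on_def by (intro exI conjI) auto
qed

lemma C1_on_det:
  fixes M :: "real \<Rightarrow> real ^ 'n ^ 'n"
  assumes "\<And>i j. C1_on J (\<lambda>s. M s $ i $ j)"
  shows "C1_on J (\<lambda>s. det (M s))"
  unfolding det_def by (intro C1_on_sum C1_on_mult C1_on_prod C1_on_const assms)

text \<open>By Cramer's rule the entries of an inverse matrix are quotients of polynomials in the
  entries of the matrix.\<close>

lemma C1_on_inverse_matrix:
  fixes M N :: "real \<Rightarrow> real ^ 'n ^ 'n"
  assumes M: "\<And>i j. C1_on J (\<lambda>s. M s $ i $ j)" and MN: "\<And>s. s \<in> J \<Longrightarrow> M s ** N s = mat 1"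
  shows "C1_on J (\<lambda>s. N s $ i $ j)"
proof -
  \<comment> \<open>The matrix of Cramer's rule for the \<open>j\<close>-th column of \<open>N\<close>, which solves \<open>M x = axis j 1\<close>.\<close>
  let ?K = "\<lambda>s. (\<chi> a b. if b = i then (if a = j then 1 else 0) else M s $ a $ b)"
  have det: "det (M s) \<noteq> 0" if "s \<in> J" for s
    using MN[OF that] by (metis det_I det_mul mult_zero_left zero_neq_one)
  have "C1_on J (\<lambda>s. det (?K s) * inverse (det (M s)))"
  proof (intro C1_on_mult C1_on_inverse C1_on_det M det)
    show "C1_on J (\<lambda>s. ?K s $ a $ b)" for a b
      using M by (cases "b = i") auto
  qed
  then show ?thesis
  proof (rule C1_on_cong)
    fix s assume s: "s \<in> J"
    have "M s *v column j (N s) = axis j 1"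
    proof -
      have "M s *v column j (N s) = column j (M s ** N s)"
        by (simp add: vec_eq_iff matrix_vector_mult_def matrix_matrix_mult_def column_def)
      then show ?thesis by (simp add: MN[OF s] vec_eq_iff column_def mat_def axis_def)
    qed
    then have "column j (N s) = (\<chi> k. det (\<chi> a b. if b = k then axis j 1 $ a else M s $ a $ b) / det (M s))"
      by (simp only: cramer[OF det[OF s]])
    then have "column j (N s) $ i = det (\<chi> a b. if b = i then axis j 1 $ a else M s $ a $ b) / det (M s)"
      by simp
    then show "N s $ i $ j = det (?K s) * inverse (det (M s))"
      by (simp add: column_def axis_def divide_inverse cong: if_cong)
  qed
qed

lemma has_vector_derivative_matrixI:
  fixes M :: "real \<Rightarrow> real ^ 'n ^ 'm"
  assumes "\<And>i j. ((\<lambda>t. M t $ i $ j) has_vector_derivative M' $ i $ j) (at s within J)"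
  shows "(M has_vector_derivative M') (at s within J)"
proof -
  have expand: "A = (\<Sum>i\<in>UNIV. \<Sum>j\<in>UNIV. (A $ i $ j) *\<^sub>R axis i (axis j 1))" for A :: "real ^ 'n ^ 'm"
  proof -
    have "(\<Sum>j\<in>UNIV. (A $ i $ j) *\<^sub>R axis i (axis j 1)) $ a $ b = (if i = a then A $ a $ b else 0)" for i a b
      by (cases "i = a") (simp_all add: axis_def if_distrib[of "\<lambda>x. _ * x"] cong: if_cong)
    then show ?thesis by (simp add: vec_eq_iff)
  qed
  have "((\<lambda>t. \<Sum>i\<in>UNIV. \<Sum>j\<in>UNIV. (M t $ i $ j) *\<^sub>R axis i (axis j 1)) has_vector_derivative
      (\<Sum>i\<in>UNIV. \<Sum>j\<in>UNIV. (M' $ i $ j) *\<^sub>R axis i (axis j (1::real)))) (at s within J)"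
    by (intro has_vector_derivative_sum
          bounded_linear.has_vector_derivative[OF bounded_linear_scaleR_left] assms)
  then show ?thesis by (simp flip: expand)
qed

lemma interval_not_isolated:
  assumes "is_interval J" "interior J \<noteq> {}" "s \<in> J"
  shows "at s within J \<noteq> (bot :: real filter)"
proof -
  have "J \<noteq> {s}" using assms(2) by auto
  then have "s islimpt J"
    using assms by (intro connected_imp_perfect) (auto simp: is_interval_connected)
  then show ?thesis by (simp add: trivial_limit_within)
qed

section \<open>Tensor fields of class \<open>C\<^sup>1\<close> along a path\<close>

lemma C1_fields_D:
  assumes "A \<in> C1_fields \<A> J \<gamma> E p q"
  shows "s \<in> J \<Longrightarrow> A s \<in> tensor_space \<A> (\<gamma> s) p q"
    and "s \<notin> J \<Longrightarrow> A s = 0"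
    and "length is = p \<Longrightarrow> length js = q \<Longrightarrow>
      C1_on J (\<lambda>s. A s (map (dual_basis \<A> (\<gamma> s) (E s)) is) (map (E s) js))"
  using assms by (auto simp: C1_fields_def tensor_fields_def)

text \<open>The arguments are replaced by basis elements one after the other, starting with the last one
  of each list; each replacement produces a sum whose coefficients are of class \<open>C\<^sup>1\<close>.\<close>

lemma C1_fields_apply:
  assumes E: "frame_along \<A> J \<gamma> E" and A: "A \<in> C1_fields \<A> J \<gamma> E p q"
    and ws: "\<And>w s. w \<in> set ws \<Longrightarrow> s \<in> J \<Longrightarrow> w s \<in> cotangent_space \<A> (\<gamma> s)"
      "\<And>w k. w \<in> set ws \<Longrightarrow> C1_on J (\<lambda>s. w s (E s k))"
    and vs: "\<And>v s. v \<in> set vs \<Longrightarrow> s \<in> J \<Longrightarrow> v s \<in> tangent_space \<A> (\<gamma> s)"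
      "\<And>v k. v \<in> set vs \<Longrightarrow> C1_on J (\<lambda>s. dual_basis \<A> (\<gamma> s) (E s) k (v s))"
    and "length ws = p" "length vs = q"
  shows "C1_on J (\<lambda>s. A s (map (\<lambda>w. w s) ws) (map (\<lambda>v. v s) vs))"
proof -
  let ?\<epsilon> = "\<lambda>s. dual_basis \<A> (\<gamma> s) (E s)"
  have e: "basis_at \<A> (\<gamma> s) (E s)" if "s \<in> J" for s using E that by (simp add: frame_along_def)
  have contra: "C1_on J (\<lambda>s. A s (map (\<lambda>w. w s) ws @ map (?\<epsilon> s) is) (map (E s) js))"
    if "length ws + length is = p" "length js = q"
      "\<forall>w\<in>set ws. (\<forall>s\<in>J. w s \<in> cotangent_space \<A> (\<gamma> s)) \<and> (\<forall>k. C1_on J (\<lambda>s. w s (E s k)))"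
    for ws "is" js
    using that
  proof (induction ws arbitrary: "is" rule: rev_induct)
    case Nil
    then show ?case using C1_fields_D(3)[OF A] by simp
  next
    case (snoc w ws)
    let ?f = "\<lambda>k s. A s (map (\<lambda>w. w s) ws @ map (?\<epsilon> s) (k # is)) (map (E s) js)"
    have "C1_on J (\<lambda>s. \<Sum>k\<in>UNIV. w s (E s k) * ?f k s)"
      using snoc.prems by (intro C1_on_sum C1_on_mult snoc.IH) auto
    then show ?case
    proof (rule C1_on_cong)
      fix s assume s: "s \<in> J"
      have "w s = (\<Sum>k\<in>UNIV. w s (E s k) *\<^sub>R ?\<epsilon> s k)"
        using snoc.prems s by (intro covector_expansion[OF e]) auto
      then show "A s (map (\<lambda>w. w s) (ws @ [w]) @ map (?\<epsilon> s) is) (map (E s) js)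
          = (\<Sum>k\<in>UNIV. w s (E s k) * ?f k s)"
        using tensor_contra_sum[where xs = "map (\<lambda>w. w s) ws" and ys = "map (?\<epsilon> s) is" and I = UNIV
            and w = "?\<epsilon> s" and c = "\<lambda>k. w s (E s k)", OF C1_fields_D(1)[OF A s] dual_basis_in[OF e[OF s]]]
        by simp
    qed
  qed
  have "C1_on J (\<lambda>s. A s (map (\<lambda>w. w s) ws) (map (\<lambda>v. v s) vs @ map (E s) js))"
    if "length vs + length js = q"
      "\<forall>v\<in>set vs. (\<forall>s\<in>J. v s \<in> tangent_space \<A> (\<gamma> s)) \<and> (\<forall>k. C1_on J (\<lambda>s. ?\<epsilon> s k (v s)))"
    for vs js
    using that
  proof (induction vs arbitrary: js rule: rev_induct)
    case Nil
    then show ?case using contra[of ws "[]" js] ws \<open>length ws = p\<close> by simp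
  next
    case (snoc v vs)
    let ?f = "\<lambda>k s. A s (map (\<lambda>w. w s) ws) (map (\<lambda>v. v s) vs @ map (E s) (k # js))"
    have "C1_on J (\<lambda>s. \<Sum>k\<in>UNIV. ?\<epsilon> s k (v s) * ?f k s)"
      using snoc.prems by (intro C1_on_sum C1_on_mult snoc.IH) auto
    then show ?case
    proof (rule C1_on_cong)
      fix s assume s: "s \<in> J"
      have "v s = (\<Sum>k\<in>UNIV. ?\<epsilon> s k (v s) *\<^sub>R E s k)"
        using snoc.prems s by (intro vector_expansion[OF e]) auto
      then show "A s (map (\<lambda>w. w s) ws) (map (\<lambda>v. v s) (vs @ [v]) @ map (E s) js)
          = (\<Sum>k\<in>UNIV. ?\<epsilon> s k (v s) * ?f k s)"
        using tensor_co_sum[where xs = "map (\<lambda>v. v s) vs" and ys = "map (E s) js" and I = UNIV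
            and w = "E s" and c = "\<lambda>k. ?\<epsilon> s k (v s)", OF C1_fields_D(1)[OF A s]
            subspace_tangent_space[OF e[OF s]] basis_at_in[OF e[OF s]]]
        by simp
    qed
  qed
  from this[of vs "[]"] show ?thesis using vs \<open>length vs = q\<close> by simp
qed

lemma C1_fields_change_subset:
  assumes E: "frame_along \<A> J \<gamma> E"
    and MN: "\<And>s. s \<in> J \<Longrightarrow> M s ** N s = mat 1"
    and M: "\<And>i j. C1_on J (\<lambda>s. M s $ i $ j)" and N: "\<And>i j. C1_on J (\<lambda>s. N s $ i $ j)"
    and G: "\<And>s j. s \<in> J \<Longrightarrow> G s j = (\<Sum>i\<in>UNIV. (M s $ i $ j) *\<^sub>R E s i)"
  shows "C1_fields \<A> J \<gamma> E p q \<subseteq> C1_fields \<A> J \<gamma> G p q"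
proof
  fix A assume A: "A \<in> C1_fields \<A> J \<gamma> E p q"
  let ?\<epsilon> = "\<lambda>s. dual_basis \<A> (\<gamma> s) (E s)" and ?\<theta> = "\<lambda>s. dual_basis \<A> (\<gamma> s) (G s)"
  have e: "basis_at \<A> (\<gamma> s) (E s)" if "s \<in> J" for s using E that by (simp add: frame_along_def)
  note change = basis_change[OF e MN G]
  have "C1_on J (\<lambda>s. A s (map (?\<theta> s) is) (map (G s) js))"
    if "length is = p" "length js = q" for "is" js
  proof -
    have "C1_on J (\<lambda>s. A s (map (\<lambda>w. w s) (map (\<lambda>i s. ?\<theta> s i) is)) (map (\<lambda>v. v s) (map (\<lambda>j s. G s j) js)))"
    proof (rule C1_fields_apply[OF E A])
      fix w k assume "w \<in> set (map (\<lambda>i s. ?\<theta> s i) is)"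
      then obtain i where w: "w = (\<lambda>s. ?\<theta> s i)" by auto
      show "w s \<in> cotangent_space \<A> (\<gamma> s)" if "s \<in> J" for s
        unfolding w using change(1) that by (intro dual_basis_in) auto
      show "C1_on J (\<lambda>s. w s (E s k))"
      proof (rule C1_on_cong[OF N[of i k]])
        fix s assume s: "s \<in> J"
        show "w s (E s k) = N s $ i $ k"
          by (simp add: w change(2)[OF s s s] sum_fun_apply dual_basis_basis[OF e[OF s]])
      qed
    next
      fix v k assume "v \<in> set (map (\<lambda>j s. G s j) js)"
      then obtain j where v: "v = (\<lambda>s. G s j)" by auto
      show "v s \<in> tangent_space \<A> (\<gamma> s)" if "s \<in> J" for s
        unfolding v using change(1) that by (intro basis_at_in) auto
      show "C1_on J (\<lambda>s. ?\<epsilon> s k (v s))"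
      proof (rule C1_on_cong[OF M[of k j]])
        fix s assume s: "s \<in> J"
        show "?\<epsilon> s k (v s) = M s $ k $ j"
          by (simp add: v G[OF s] dual_basis_combination[OF e[OF s]])
      qed
    qed (use that in auto)
    then show ?thesis by (simp add: comp_def)
  qed
  then show "A \<in> C1_fields \<A> J \<gamma> G p q" using A by (simp add: C1_fields_def)
qed

text \<open>One inclusion suffices, because the inverse matrix is of class \<open>C\<^sup>1\<close> as well and describes the
  change of frame in the opposite direction.\<close>

lemma C1_fields_change:
  assumes E: "frame_along \<A> J \<gamma> E"
    and MN: "\<And>s. s \<in> J \<Longrightarrow> M s ** N s = mat 1"
    and M: "\<And>i j. C1_on J (\<lambda>s. M s $ i $ j)"
    and G: "\<And>s j. s \<in> J \<Longrightarrow> G s j = (\<Sum>i\<in>UNIV. (M s $ i $ j) *\<^sub>R E s i)"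
  shows "frame_along \<A> J \<gamma> G" and "C1_fields \<A> J \<gamma> G = C1_fields \<A> J \<gamma> E"
proof -
  have e: "basis_at \<A> (\<gamma> s) (E s)" if "s \<in> J" for s using E that by (simp add: frame_along_def)
  show G_frame: "frame_along \<A> J \<gamma> G"
    unfolding frame_along_def using basis_change(1)[OF e MN G] by blast
  have N: "C1_on J (\<lambda>s. N s $ i $ j)" for i j
    by (rule C1_on_inverse_matrix[OF M MN])
  have NM: "N s ** M s = mat 1" if "s \<in> J" for s
    using MN[OF that] by (simp only: matrix_left_right_inverse[of "M s"])
  have EG: "E s j = (\<Sum>i\<in>UNIV. (N s $ i $ j) *\<^sub>R G s i)" if s: "s \<in> J" for s j
  proof -
    have g: "basis_at \<A> (\<gamma> s) (G s)" by (rule basis_change(1)[OF e[OF s] MN[OF s] G[OF s]])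
    have "dual_basis \<A> (\<gamma> s) (G s) i (E s j) = N s $ i $ j" for i
      by (simp add: basis_change(2)[OF e[OF s] MN[OF s] G[OF s]] sum_fun_apply
            dual_basis_basis[OF e[OF s]])
    then show ?thesis using vector_expansion[OF g basis_at_in[OF e[OF s]], of j] by simp
  qed
  show "C1_fields \<A> J \<gamma> G = C1_fields \<A> J \<gamma> E"
    using C1_fields_change_subset[OF E MN M N G] C1_fields_change_subset[OF G_frame NM N M EG]
    by (intro ext) blast
qed

lemma contract_C1_fields:
  assumes E: "frame_along \<A> J \<gamma> E" and A: "A \<in> C1_fields \<A> J \<gamma> E (Suc p) (Suc q)"
  shows "(\<lambda>s. contract \<A> (\<gamma> s) i j (A s)) \<in> C1_fields \<A> J \<gamma> E p q"
proof -
  let ?\<epsilon> = "\<lambda>s. dual_basis \<A> (\<gamma> s) (E s)"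
  have e: "basis_at \<A> (\<gamma> s) (E s)" if "s \<in> J" for s using E that by (simp add: frame_along_def)
  have "C1_on J (\<lambda>s. contract \<A> (\<gamma> s) i j (A s) (map (?\<epsilon> s) is) (map (E s) js))"
    if "length is = p" "length js = q" for "is" js
  proof -
    have "C1_on J (\<lambda>s. \<Sum>k\<in>UNIV. A s (map (?\<epsilon> s) (insert_at i k is)) (map (E s) (insert_at j k js)))"
      using that by (intro C1_on_sum C1_fields_D(3)[OF A]) auto
    then show ?thesis
    proof (rule C1_on_cong)
      fix s assume "s \<in> J"
      then show "contract \<A> (\<gamma> s) i j (A s) (map (?\<epsilon> s) is) (map (E s) js)
          = (\<Sum>k\<in>UNIV. A s (map (?\<epsilon> s) (insert_at i k is)) (map (E s) (insert_at j k js)))"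
        by (simp add: contract_basis[OF e C1_fields_D(1)[OF A]] map_insert_at)
    qed
  qed
  moreover have "contract \<A> (\<gamma> s) i j (A s) = 0" if "s \<notin> J" for s
    using C1_fields_D(2)[OF A that] by (simp add: contract_def Let_def fun_eq_iff)
  ultimately show ?thesis
    using contract_in[OF e C1_fields_D(1)[OF A]] by (simp add: C1_fields_def tensor_fields_def)
qed

lemma tensor_prod_C1_fields:
  assumes E: "frame_along \<A> J \<gamma> E" and A: "A \<in> C1_fields \<A> J \<gamma> E p q"
    and B: "B \<in> C1_fields \<A> J \<gamma> E p' q'"
  shows "(\<lambda>s. tensor_prod p q (A s) (B s)) \<in> C1_fields \<A> J \<gamma> E (p + p') (q + q')"
proof -
  have T: "subspace (tangent_space \<A> (\<gamma> s))" if "s \<in> J" for s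
    using E that by (auto simp: frame_along_def intro: subspace_tangent_space)
  have "C1_on J (\<lambda>s. tensor_prod p q (A s) (B s) (map (dual_basis \<A> (\<gamma> s) (E s)) is) (map (E s) js))"
    if "length is = p + p'" "length js = q + q'" for "is" js
    unfolding tensor_prod_def take_map drop_map
    using that by (intro C1_on_mult C1_fields_D(3)[OF A] C1_fields_D(3)[OF B]) auto
  moreover have "tensor_prod p q (A s) (B s) = 0" if "s \<notin> J" for s
    using C1_fields_D(2)[OF A that] by (simp add: tensor_prod_def fun_eq_iff)
  ultimately show ?thesis
    using tensor_prod_in[OF C1_fields_D(1)[OF A] C1_fields_D(1)[OF B] T]
    by (simp add: C1_fields_def tensor_fields_def)
qed

lemma subspace_C1_fields: "subspace (C1_fields \<A> J \<gamma> E p q)"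
  unfolding subspace_def C1_fields_def tensor_fields_def
  by (auto intro: subspace_add subspace_scale subspace_0 subspace_tensor_space C1_on_add
        C1_on_mult[OF C1_on_const])

section \<open>The derivation annihilating a frame\<close>

locale frame_on_interval =
  fixes \<A> :: "('m, 'n::finite) chart set" and J :: "real set" and \<gamma> :: "real \<Rightarrow> 'm"
    and G :: "real \<Rightarrow> 'n \<Rightarrow> ('m, 'n) tvec"
  assumes frame: "frame_along \<A> J \<gamma> G"
    and not_isolated: "s \<in> J \<Longrightarrow> at s within J \<noteq> bot"
begin

abbreviation T :: "real \<Rightarrow> ('m, 'n) tvec set" where "T s \<equiv> tangent_space \<A> (\<gamma> s)"

abbreviation T' :: "real \<Rightarrow> ('m, 'n) covec set" where "T' s \<equiv> cotangent_space \<A> (\<gamma> s)"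

abbreviation \<theta> :: "real \<Rightarrow> 'n \<Rightarrow> ('m, 'n) covec" where "\<theta> s \<equiv> dual_basis \<A> (\<gamma> s) (G s)"

abbreviation fields :: "nat \<Rightarrow> nat \<Rightarrow> ('m, 'n) tensor_field set" where
  "fields \<equiv> C1_fields \<A> J \<gamma> G"

text \<open>The vector at \<open>\<gamma>(t)\<close> which has the same components in the frame \<open>G\<close> as \<open>v\<close> has at \<open>\<gamma>(s)\<close>:
  the linear transport along \<open>\<gamma>\<close> for which \<open>G\<close> is parallel.\<close>

definition shift_vector :: "real \<Rightarrow> real \<Rightarrow> ('m, 'n) tvec \<Rightarrow> ('m, 'n) tvec" where
  "shift_vector s t v = (\<Sum>k\<in>UNIV. \<theta> s k v *\<^sub>R G t k)"

definition shift_covector :: "real \<Rightarrow> real \<Rightarrow> ('m, 'n) covec \<Rightarrow> ('m, 'n) covec" where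
  "shift_covector s t \<omega> = (\<Sum>k\<in>UNIV. \<omega> (G s k) *\<^sub>R \<theta> t k)"

abbreviation shifted_value ::
  "('m, 'n) tensor_field \<Rightarrow> real \<Rightarrow> ('m, 'n) covec list \<Rightarrow> ('m, 'n) tvec list \<Rightarrow> real \<Rightarrow> real" where
  "shifted_value A s \<omega>s vs t \<equiv> A t (map (shift_covector s t) \<omega>s) (map (shift_vector s t) vs)"

text \<open>The derivative, at \<open>t = s\<close>, of the field carried back from \<open>\<gamma>(t)\<close> to \<open>\<gamma>(s)\<close>. Equivalently its
  components in the frame \<open>G\<close> are the derivatives of the components of the field. Formulated with
  arbitrary arguments instead of basis elements, it is multilinear by its very form.
  The default value \<open>0\<close> is the one which tensors take on arguments outside their domain.\<close>

definition frame_derivative :: "('m, 'n) tensor_field \<Rightarrow> ('m, 'n) tensor_field" where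
  "frame_derivative A = (\<lambda>s \<omega>s vs.
     if s \<in> J \<and> set \<omega>s \<subseteq> T' s \<and> set vs \<subseteq> T s
     then vector_derivative (shifted_value A s \<omega>s vs) (at s within J) else 0)"

definition frame_derivation :: "('m, 'n) tensor_field \<Rightarrow> ('m, 'n) tensor_field" where
  "frame_derivation = restrict frame_derivative (\<Union>p q. fields p q)"

lemma basis: "s \<in> J \<Longrightarrow> basis_at \<A> (\<gamma> s) (G s)"
  using frame by (simp add: frame_along_def)

lemma subspace_T: "s \<in> J \<Longrightarrow> subspace (T s)"
  by (rule subspace_tangent_space[OF basis])

lemma shift_vector_in: "t \<in> J \<Longrightarrow> shift_vector s t v \<in> T t"
  unfolding shift_vector_def by (rule tangent_space_combination[OF basis])

lemma shift_covector_in: "t \<in> J \<Longrightarrow> shift_covector s t \<omega> \<in> T' t"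
  unfolding shift_covector_def by (rule cotangent_space_combination[OF basis])

lemma shift_vector_basis: "s \<in> J \<Longrightarrow> shift_vector s t (G s k) = G t k"
  by (simp add: shift_vector_def dual_basis_basis[OF basis] if_distrib[of "\<lambda>x. x *\<^sub>R _"] cong: if_cong)

lemma shift_covector_basis: "s \<in> J \<Longrightarrow> shift_covector s t (\<theta> s k) = \<theta> t k"
  by (simp add: shift_covector_def dual_basis_basis[OF basis] if_distrib[of "\<lambda>x. x *\<^sub>R _"] cong: if_cong)

lemma shift_vector_self: "s \<in> J \<Longrightarrow> v \<in> T s \<Longrightarrow> shift_vector s s v = v"
  unfolding shift_vector_def by (rule vector_expansion[OF basis, symmetric])

lemma shift_covector_self: "s \<in> J \<Longrightarrow> \<omega> \<in> T' s \<Longrightarrow> shift_covector s s \<omega> = \<omega>"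
  unfolding shift_covector_def by (rule covector_expansion[OF basis, symmetric])

lemma shift_vector_linear:
  assumes "s \<in> J" "v \<in> T s" "w \<in> T s"
  shows "shift_vector s t (a *\<^sub>R v + b *\<^sub>R w) = a *\<^sub>R shift_vector s t v + b *\<^sub>R shift_vector s t w"
  using cotangent_space_linear[OF dual_basis_in[OF basis[OF assms(1)]]] assms(2,3)
  by (simp add: shift_vector_def real_linear_on_def scaleR_add_left sum.distrib scaleR_sum_right)

lemma shift_covector_linear:
  "shift_covector s t (a *\<^sub>R \<omega> + b *\<^sub>R \<eta>) = a *\<^sub>R shift_covector s t \<omega> + b *\<^sub>R shift_covector s t \<eta>"
  by (simp add: shift_covector_def scaleR_add_left sum.distrib scaleR_sum_right)

lemma shift_covector_apply:
  assumes "t \<in> J" "s \<in> J" "\<omega> \<in> T' s" "v \<in> T t"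
  shows "shift_covector s t \<omega> v = \<omega> (shift_vector t s v)"
  by (simp add: shift_covector_def shift_vector_def sum_fun_apply
        covector_sum[OF basis[OF assms(2)] assms(3) basis_at_in[OF basis[OF assms(2)]]] mult.commute)

lemma map_shift_self:
  assumes "s \<in> J"
  shows "set \<omega>s \<subseteq> T' s \<Longrightarrow> map (shift_covector s s) \<omega>s = \<omega>s"
    and "set vs \<subseteq> T s \<Longrightarrow> map (shift_vector s s) vs = vs"
  using assms by (auto intro!: map_idI shift_covector_self shift_vector_self)

text \<open>Shifted arguments have constant components in the frame.\<close>

lemma C1_shifted_value:
  assumes A: "A \<in> fields p q" and s: "s \<in> J" and "set \<omega>s \<subseteq> T' s" "set vs \<subseteq> T s"
  shows "C1_on J (shifted_value A s \<omega>s vs)"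
proof (cases "length \<omega>s = p \<and> length vs = q")
  case True
  have "C1_on J (\<lambda>t. A t (map (\<lambda>w. w t) (map (\<lambda>\<omega> t. shift_covector s t \<omega>) \<omega>s))
                        (map (\<lambda>v. v t) (map (\<lambda>v t. shift_vector s t v) vs)))"
  proof (rule C1_fields_apply[OF frame A])
    fix w k assume "w \<in> set (map (\<lambda>\<omega> t. shift_covector s t \<omega>) \<omega>s)"
    then obtain \<omega> where w: "w = (\<lambda>t. shift_covector s t \<omega>)" by auto
    show "w t \<in> T' t" if "t \<in> J" for t by (simp add: w shift_covector_in that)
    show "C1_on J (\<lambda>t. w t (G t k))"
      by (rule C1_on_cong[OF C1_on_const[of _ "\<omega> (G s k)"]])
         (simp add: w shift_covector_def sum_fun_apply dual_basis_basis[OF basis])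
  next
    fix v k assume "v \<in> set (map (\<lambda>v t. shift_vector s t v) vs)"
    then obtain v' where v: "v = (\<lambda>t. shift_vector s t v')" by auto
    show "v t \<in> T t" if "t \<in> J" for t by (simp add: v shift_vector_in that)
    show "C1_on J (\<lambda>t. \<theta> t k (v t))"
      by (rule C1_on_cong[OF C1_on_const[of _ "\<theta> s k v'"]])
         (simp add: v shift_vector_def dual_basis_combination[OF basis])
  qed (use True in auto)
  then show ?thesis by (simp add: comp_def)
next
  case False
  have "shifted_value A s \<omega>s vs t = 0" if "t \<in> J" for t
    using False by (intro tensor_outside[OF C1_fields_D(1)[OF A that]]) (auto simp: tuples_def)
  then show ?thesis by (rule C1_on_cong[OF C1_on_const])
qed

text \<open>At an isolated point of \<open>J\<close> every number would be a derivative within \<open>J\<close>.\<close>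

lemma derivative_unique:
  assumes "s \<in> J" "(g has_vector_derivative d) (at s within J)" "\<And>t. t \<in> J \<Longrightarrow> f t = g t"
  shows "vector_derivative f (at s within J) = d"
  using assms has_vector_derivative_transform[OF assms(1,3,2)]
  by (intro vector_derivative_within not_isolated)

lemma frame_derivative_has_derivative:
  assumes "A \<in> fields p q" "s \<in> J" "set \<omega>s \<subseteq> T' s" "set vs \<subseteq> T s"
  shows "(shifted_value A s \<omega>s vs has_vector_derivative frame_derivative A s \<omega>s vs) (at s within J)"
  using C1_on_has_derivative[OF C1_shifted_value[OF assms] assms(2)] assms
  by (simp add: frame_derivative_def)

lemma frame_derivative_eqI:
  assumes "s \<in> J" "set \<omega>s \<subseteq> T' s" "set vs \<subseteq> T s"
    and "(g has_vector_derivative d) (at s within J)"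
    and "\<And>t. t \<in> J \<Longrightarrow> shifted_value A s \<omega>s vs t = g t"
  shows "frame_derivative A s \<omega>s vs = d"
  using derivative_unique[OF assms(1,4,5)] assms(1-3) by (simp add: frame_derivative_def)

lemma frame_derivative_outside:
  assumes A: "A \<in> fields p q"
    and out: "\<not> (s \<in> J \<and> \<omega>s \<in> tuples (T' s) p \<and> vs \<in> tuples (T s) q)"
  shows "frame_derivative A s \<omega>s vs = 0"
proof (cases "s \<in> J \<and> set \<omega>s \<subseteq> T' s \<and> set vs \<subseteq> T s")
  case True
  with out have len: "\<not> (length \<omega>s = p \<and> length vs = q)" by (auto simp: tuples_def)
  show ?thesis
  proof (rule frame_derivative_eqI[where g = "\<lambda>t. 0"])
    show "shifted_value A s \<omega>s vs t = 0" if "t \<in> J" for t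
      using len by (intro tensor_outside[OF C1_fields_D(1)[OF A that]]) (auto simp: tuples_def)
  qed (use True in auto)
qed (auto simp: frame_derivative_def)

lemma frame_derivative_in:
  assumes A: "A \<in> fields p q"
  shows "frame_derivative A \<in> tensor_fields \<A> J \<gamma> p q"
proof -
  have "frame_derivative A s \<in> tensor_space \<A> (\<gamma> s) p q" if s: "s \<in> J" for s
  proof (rule tensor_spaceI)
    fix xs ys vs \<omega> \<eta> and a b :: real
    assume sets: "set xs \<subseteq> T' s" "set ys \<subseteq> T' s" "vs \<in> tuples (T s) q"
      and \<omega>: "\<omega> \<in> T' s" and \<eta>: "\<eta> \<in> T' s"
    let ?D = "\<lambda>\<omega>. frame_derivative A s (xs @ \<omega> # ys) vs"
    have mem: "set (xs @ \<omega> # ys) \<subseteq> T' s" "set (xs @ \<eta> # ys) \<subseteq> T' s"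
      "set (xs @ (a *\<^sub>R \<omega> + b *\<^sub>R \<eta>) # ys) \<subseteq> T' s" "set vs \<subseteq> T s"
      using sets \<omega> \<eta> by (auto simp: tuples_def subspace_add subspace_scale subspace_cotangent_space)
    show "?D (a *\<^sub>R \<omega> + b *\<^sub>R \<eta>) = a * ?D \<omega> + b * ?D \<eta>"
    proof (rule frame_derivative_eqI[OF s mem(3,4)])
      show "((\<lambda>t. a * shifted_value A s (xs @ \<omega> # ys) vs t + b * shifted_value A s (xs @ \<eta> # ys) vs t)
          has_vector_derivative a * ?D \<omega> + b * ?D \<eta>) (at s within J)"
        by (intro has_vector_derivative_add has_vector_derivative_mult_right
              frame_derivative_has_derivative[OF A s] mem)
      fix t assume t: "t \<in> J"
      show "shifted_value A s (xs @ (a *\<^sub>R \<omega> + b *\<^sub>R \<eta>) # ys) vs t =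
          a * shifted_value A s (xs @ \<omega> # ys) vs t + b * shifted_value A s (xs @ \<eta> # ys) vs t"
        using tensor_contra_linear[OF C1_fields_D(1)[OF A t]] shift_covector_in[OF t]
        by (simp add: shift_covector_linear real_linear_on_def)
    qed
  next
    fix xs ys \<omega>s v w and a b :: real
    assume sets: "set xs \<subseteq> T s" "set ys \<subseteq> T s" "\<omega>s \<in> tuples (T' s) p"
      and v: "v \<in> T s" and w: "w \<in> T s"
    let ?D = "\<lambda>v. frame_derivative A s \<omega>s (xs @ v # ys)"
    have mem: "set \<omega>s \<subseteq> T' s" "set (xs @ v # ys) \<subseteq> T s" "set (xs @ w # ys) \<subseteq> T s"
      "set (xs @ (a *\<^sub>R v + b *\<^sub>R w) # ys) \<subseteq> T s"
      using sets v w by (auto simp: tuples_def subspace_add subspace_scale subspace_T[OF s])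
    show "?D (a *\<^sub>R v + b *\<^sub>R w) = a * ?D v + b * ?D w"
    proof (rule frame_derivative_eqI[OF s mem(1,4)])
      show "((\<lambda>t. a * shifted_value A s \<omega>s (xs @ v # ys) t + b * shifted_value A s \<omega>s (xs @ w # ys) t)
          has_vector_derivative a * ?D v + b * ?D w) (at s within J)"
        by (intro has_vector_derivative_add has_vector_derivative_mult_right
              frame_derivative_has_derivative[OF A s] mem)
      fix t assume t: "t \<in> J"
      show "shifted_value A s \<omega>s (xs @ (a *\<^sub>R v + b *\<^sub>R w) # ys) t =
          a * shifted_value A s \<omega>s (xs @ v # ys) t + b * shifted_value A s \<omega>s (xs @ w # ys) t"
        using tensor_co_linear[OF C1_fields_D(1)[OF A t] subspace_T[OF t]] shift_vector_in[OF t]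
        by (simp add: shift_vector_linear[OF s v w] real_linear_on_def)
    qed
  qed (use frame_derivative_outside[OF A] in blast)
  moreover have "frame_derivative A s = 0" if "s \<notin> J" for s
    using that by (simp add: frame_derivative_def fun_eq_iff)
  ultimately show ?thesis by (simp add: tensor_fields_def)
qed

lemma frame_derivative_linear:
  assumes A: "A \<in> fields p q" and B: "B \<in> fields p q"
  shows "frame_derivative (a *\<^sub>R A + b *\<^sub>R B) = a *\<^sub>R frame_derivative A + b *\<^sub>R frame_derivative B"
proof (intro ext)
  fix s \<omega>s vs
  show "frame_derivative (a *\<^sub>R A + b *\<^sub>R B) s \<omega>s vs
      = (a *\<^sub>R frame_derivative A + b *\<^sub>R frame_derivative B) s \<omega>s vs"
  proof (cases "s \<in> J \<and> set \<omega>s \<subseteq> T' s \<and> set vs \<subseteq> T s")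
    case True
    have "((\<lambda>t. a * shifted_value A s \<omega>s vs t + b * shifted_value B s \<omega>s vs t) has_vector_derivative
        a * frame_derivative A s \<omega>s vs + b * frame_derivative B s \<omega>s vs) (at s within J)"
      using True by (intro has_vector_derivative_add has_vector_derivative_mult_right
              frame_derivative_has_derivative[OF A] frame_derivative_has_derivative[OF B]) auto
    then show ?thesis
      using True by (simp add: frame_derivative_eqI)
  qed (auto simp: frame_derivative_def)
qed

text \<open>A contraction at \<open>\<gamma>(t)\<close> may be computed in the frame \<open>G\<close>, whose elements and their duals are
  shifts of those at \<open>\<gamma>(s)\<close>. It is then a sum of shifted values of the field, with a number of terms
  that does not depend on \<open>t\<close>.\<close>

lemma frame_derivative_contract:
  assumes A: "A \<in> fields (Suc p) (Suc q)"
  shows "frame_derivative (\<lambda>s. contract \<A> (\<gamma> s) i j (A s))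
    = (\<lambda>s. contract \<A> (\<gamma> s) i j (frame_derivative A s))"
proof (intro ext)
  fix s \<omega>s vs
  let ?C = "\<lambda>s. contract \<A> (\<gamma> s) i j (A s)"
  have in_space: "frame_derivative A s \<in> tensor_space \<A> (\<gamma> s) (Suc p) (Suc q)" if "s \<in> J"
    using frame_derivative_in[OF A] that by (simp add: tensor_fields_def)
  consider "s \<notin> J" | "s \<in> J" "\<not> (set \<omega>s \<subseteq> T' s \<and> set vs \<subseteq> T s)"
    | "s \<in> J" "set \<omega>s \<subseteq> T' s" "set vs \<subseteq> T s" by blast
  then show "frame_derivative ?C s \<omega>s vs = contract \<A> (\<gamma> s) i j (frame_derivative A s) \<omega>s vs"
  proof cases
    case 1
    then show ?thesis by (simp add: frame_derivative_def contract_def Let_def)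
  next
    case 2
    then have "contract \<A> (\<gamma> s) i j (frame_derivative A s) \<omega>s vs = 0"
      by (intro tensor_outside[OF contract_in[OF basis in_space]]) (auto simp: tuples_def)
    then show ?thesis using 2 by (auto simp: frame_derivative_def)
  next
    case 3
    note s = 3(1)
    let ?a = "\<lambda>k. insert_at i (\<theta> s k) \<omega>s" and ?b = "\<lambda>k. insert_at j (G s k) vs"
    show ?thesis
    proof (rule frame_derivative_eqI[OF 3])
      show "((\<lambda>t. \<Sum>k\<in>UNIV. shifted_value A s (?a k) (?b k) t) has_vector_derivative
          contract \<A> (\<gamma> s) i j (frame_derivative A s) \<omega>s vs) (at s within J)"
        unfolding contract_basis[OF basis[OF s] in_space[OF s]]
        using 3 by (intro has_vector_derivative_sum frame_derivative_has_derivative[OF A s])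
          (auto simp: dual_basis_in[OF basis] basis_at_in[OF basis])
      fix t assume "t \<in> J"
      then show "shifted_value ?C s \<omega>s vs t = (\<Sum>k\<in>UNIV. shifted_value A s (?a k) (?b k) t)"
        by (simp add: contract_basis[OF basis C1_fields_D(1)[OF A]] map_insert_at
              shift_covector_basis[OF s] shift_vector_basis[OF s])
    qed
  qed
qed

text \<open>Shifting acts on each argument separately, so the product of fields becomes a product of two
  real functions, and the Leibniz rule is the one of calculus.\<close>

lemma frame_derivative_tensor_prod:
  assumes A: "A \<in> fields p q" and B: "B \<in> fields p' q'"
  shows "frame_derivative (\<lambda>s. tensor_prod p q (A s) (B s))
    = (\<lambda>s. tensor_prod p q (frame_derivative A s) (B s) + tensor_prod p q (A s) (frame_derivative B s))"
proof (intro ext)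
  fix s \<omega>s vs
  let ?P = "\<lambda>s. tensor_prod p q (A s) (B s)"
  let ?R = "tensor_prod p q (frame_derivative A s) (B s) + tensor_prod p q (A s) (frame_derivative B s)"
  have in_space: "frame_derivative A s \<in> tensor_space \<A> (\<gamma> s) p q"
    "frame_derivative B s \<in> tensor_space \<A> (\<gamma> s) p' q'" if "s \<in> J"
    using frame_derivative_in[OF A] frame_derivative_in[OF B] that by (auto simp: tensor_fields_def)
  consider "s \<notin> J" | "s \<in> J" "\<not> (set \<omega>s \<subseteq> T' s \<and> set vs \<subseteq> T s)"
    | "s \<in> J" "set \<omega>s \<subseteq> T' s" "set vs \<subseteq> T s" by blast
  then show "frame_derivative ?P s \<omega>s vs = ?R \<omega>s vs"
  proof cases
    case 1
    then show ?thesis by (simp add: frame_derivative_def tensor_prod_def)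
  next
    case 2
    then have "?R \<in> tensor_space \<A> (\<gamma> s) (p + p') (q + q')"
      by (intro subspace_add subspace_tensor_space tensor_prod_in C1_fields_D(1)[OF A]
            C1_fields_D(1)[OF B] in_space subspace_T)
    then have "?R \<omega>s vs = 0"
      by (rule tensor_outside) (use 2 in \<open>auto simp: tuples_def\<close>)
    then show ?thesis using 2 by (auto simp: frame_derivative_def)
  next
    case 3
    note s = 3(1)
    have mem: "set (take p \<omega>s) \<subseteq> T' s" "set (drop p \<omega>s) \<subseteq> T' s" "set (take q vs) \<subseteq> T s"
      "set (drop q vs) \<subseteq> T s"
      using 3 set_take_subset set_drop_subset by (metis order_trans)+
    have "((\<lambda>t. shifted_value A s (take p \<omega>s) (take q vs) t * shifted_value B s (drop p \<omega>s) (drop q vs) t)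
        has_vector_derivative
        shifted_value A s (take p \<omega>s) (take q vs) s * frame_derivative B s (drop p \<omega>s) (drop q vs)
        + frame_derivative A s (take p \<omega>s) (take q vs) * shifted_value B s (drop p \<omega>s) (drop q vs) s)
        (at s within J)"
      by (intro has_vector_derivative_mult frame_derivative_has_derivative[OF A s]
            frame_derivative_has_derivative[OF B s] mem)
    then have "frame_derivative ?P s \<omega>s vs =
        shifted_value A s (take p \<omega>s) (take q vs) s * frame_derivative B s (drop p \<omega>s) (drop q vs)
        + frame_derivative A s (take p \<omega>s) (take q vs) * shifted_value B s (drop p \<omega>s) (drop q vs) s"
      by (rule frame_derivative_eqI[OF 3]) (simp add: tensor_prod_def take_map drop_map)
    then show ?thesis
      by (simp add: tensor_prod_def map_shift_self[OF s] mem)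
  qed
qed

lemma frame_derivation_eq: "A \<in> fields p q \<Longrightarrow> frame_derivation A = frame_derivative A"
  unfolding frame_derivation_def by (rule restrict_apply') blast

lemma frame_derivation_derivation: "derivation_along \<A> J \<gamma> G frame_derivation"
  unfolding derivation_along_def
proof (intro conjI allI impI ballI)
  fix p q
  show "frame_derivation ` fields p q \<subseteq> tensor_fields \<A> J \<gamma> p q"
    by (auto simp: frame_derivation_eq frame_derivative_in)
  show "real_linear_on (fields p q) frame_derivation"
    unfolding real_linear_on_def
  proof (intro ballI allI)
    fix A B a b assume A: "A \<in> fields p q" and B: "B \<in> fields p q"
    then have "a *\<^sub>R A + b *\<^sub>R B \<in> fields p q"
      by (intro subspace_add subspace_scale subspace_C1_fields)
    then show "frame_derivation (a *\<^sub>R A + b *\<^sub>R B) = a *\<^sub>R frame_derivation A + b *\<^sub>R frame_derivation B"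
      by (simp only: frame_derivation_eq frame_derivative_linear[OF A B] frame_derivation_eq[OF A]
            frame_derivation_eq[OF B])
  qed
next
  fix p q i j :: nat and A assume "i < p" "j < q" and "A \<in> fields p q"
  then obtain p' q' where A: "A \<in> fields (Suc p') (Suc q')" by (metis less_imp_Suc_add)
  show "frame_derivation (\<lambda>s. contract \<A> (\<gamma> s) i j (A s))
      = (\<lambda>s. contract \<A> (\<gamma> s) i j (frame_derivation A s))"
    by (simp only: frame_derivation_eq[OF contract_C1_fields[OF frame A]]
          frame_derivation_eq[OF A] frame_derivative_contract[OF A])
next
  fix p q p' q' A B assume A: "A \<in> fields p q" and B: "B \<in> fields p' q'"
  show "frame_derivation (\<lambda>s. tensor_prod p q (A s) (B s)) = (\<lambda>s.
      tensor_prod p q (frame_derivation A s) (B s) + tensor_prod p q (A s) (frame_derivation B s))"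
    by (simp only: frame_derivation_eq[OF tensor_prod_C1_fields[OF frame A B]]
          frame_derivation_eq[OF A] frame_derivation_eq[OF B] frame_derivative_tensor_prod[OF A B])
qed (simp add: frame_derivation_def)

lemma scalar_field_in:
  assumes "C1_on J f"
  shows "scalar_field J f \<in> fields 0 0"
proof -
  have "C1_on J (\<lambda>s. scalar_field J f s [] [])"
    by (rule C1_on_cong[OF assms]) (simp add: scalar_field_def scalar_tensor_def)
  then show ?thesis
    by (simp add: C1_fields_def tensor_fields_def scalar_field_def scalar_tensor_in)
qed

lemma frame_derivation_differentiates: "differentiates_functions J frame_derivation"
  unfolding differentiates_functions_def
proof (intro allI impI)
  fix f :: "real \<Rightarrow> real" assume f: "C1_on J f"
  note F = scalar_field_in[OF f]
  show "frame_derivation (scalar_field J f) = scalar_field J (\<lambda>s. vector_derivative f (at s within J))"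
    unfolding frame_derivation_eq[OF F]
  proof (intro ext)
    fix s \<omega>s vs
    show "frame_derivative (scalar_field J f) s \<omega>s vs
        = scalar_field J (\<lambda>s. vector_derivative f (at s within J)) s \<omega>s vs"
    proof (cases "s \<in> J \<and> \<omega>s = [] \<and> vs = []")
      case True
      then show ?thesis
        using frame_derivative_eqI[OF _ _ _ C1_on_has_derivative[OF f], of s "[]" "[]" "scalar_field J f"]
        by (simp add: scalar_field_def scalar_tensor_def)
    next
      case False
      then have "frame_derivative (scalar_field J f) s \<omega>s vs = 0"
        by (intro frame_derivative_outside[OF F]) (auto simp: tuples_def)
      then show ?thesis using False by (auto simp: scalar_field_def scalar_tensor_def)
    qed
  qed
qed

end

section \<open>Uniqueness of derivations\<close>

lemma derivation_alongD:
  assumes "derivation_along \<A> J \<gamma> E D"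
  shows "A \<in> C1_fields \<A> J \<gamma> E p q \<Longrightarrow> D A \<in> tensor_fields \<A> J \<gamma> p q"
    and "A \<in> C1_fields \<A> J \<gamma> E p q \<Longrightarrow> B \<in> C1_fields \<A> J \<gamma> E p q \<Longrightarrow>
      D (a *\<^sub>R A + b *\<^sub>R B) = a *\<^sub>R D A + b *\<^sub>R D B"
    and "i < p \<Longrightarrow> j < q \<Longrightarrow> A \<in> C1_fields \<A> J \<gamma> E p q \<Longrightarrow>
      D (\<lambda>s. contract \<A> (\<gamma> s) i j (A s)) = (\<lambda>s. contract \<A> (\<gamma> s) i j (D A s))"
    and "A \<in> C1_fields \<A> J \<gamma> E p q \<Longrightarrow> B \<in> C1_fields \<A> J \<gamma> E p' q' \<Longrightarrow>
      D (\<lambda>s. tensor_prod p q (A s) (B s)) =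
        (\<lambda>s. tensor_prod p q (D A s) (B s) + tensor_prod p q (A s) (D B s))"
    and "D \<in> extensional (\<Union>p q. C1_fields \<A> J \<gamma> E p q)"
proof -
  note D = assms[unfolded derivation_along_def]
  show "A \<in> C1_fields \<A> J \<gamma> E p q \<Longrightarrow> D A \<in> tensor_fields \<A> J \<gamma> p q"
    using D[THEN conjunct1] by blast
  show "A \<in> C1_fields \<A> J \<gamma> E p q \<Longrightarrow> B \<in> C1_fields \<A> J \<gamma> E p q \<Longrightarrow>
      D (a *\<^sub>R A + b *\<^sub>R B) = a *\<^sub>R D A + b *\<^sub>R D B"
    by (rule D[THEN conjunct2, THEN conjunct1, unfolded real_linear_on_def, rule_format])
  show "i < p \<Longrightarrow> j < q \<Longrightarrow> A \<in> C1_fields \<A> J \<gamma> E p q \<Longrightarrow>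
      D (\<lambda>s. contract \<A> (\<gamma> s) i j (A s)) = (\<lambda>s. contract \<A> (\<gamma> s) i j (D A s))"
    by (rule D[THEN conjunct2, THEN conjunct2, THEN conjunct1, rule_format])
  show "A \<in> C1_fields \<A> J \<gamma> E p q \<Longrightarrow> B \<in> C1_fields \<A> J \<gamma> E p' q' \<Longrightarrow>
      D (\<lambda>s. tensor_prod p q (A s) (B s)) =
        (\<lambda>s. tensor_prod p q (D A s) (B s) + tensor_prod p q (A s) (D B s))"
    by (rule D[THEN conjunct2, THEN conjunct2, THEN conjunct2, THEN conjunct1, rule_format])
  show "D \<in> extensional (\<Union>p q. C1_fields \<A> J \<gamma> E p q)"
    by (rule D[THEN conjunct2, THEN conjunct2, THEN conjunct2, THEN conjunct2])
qed

lemma contract_add: "contract \<A> x i j (A + B) = contract \<A> x i j A + contract \<A> x i j B"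
  by (simp add: contract_def Let_def fun_eq_iff sum.distrib)

context frame_on_interval
begin

abbreviation frame_field :: "'n \<Rightarrow> ('m, 'n) tensor_field" where
  "frame_field \<equiv> vector_field \<A> J \<gamma> G"

definition coframe_field :: "'n \<Rightarrow> ('m, 'n) tensor_field" where
  "coframe_field i = (\<lambda>s. if s \<in> J then covector_tensor \<A> (\<gamma> s) (\<theta> s i) else 0)"

lemma frame_field_in: "frame_field i \<in> fields 1 0"
proof -
  have "C1_on J (\<lambda>s. frame_field i s (map (\<theta> s) is) [])" if len: "length is = 1" for "is"
  proof -
    obtain k where k: "is = [k]" using len by (cases "is") auto
    show ?thesis
      by (rule C1_on_cong[OF C1_on_const[of _ "if k = i then 1 else 0"]])
         (simp add: k vector_field_def vector_tensor_apply dual_basis_in[OF basis] dual_basis_basis[OF basis])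
  qed
  moreover have "frame_field i \<in> tensor_fields \<A> J \<gamma> 1 0"
    unfolding tensor_fields_def vector_field_def using vector_tensor_in by auto
  ultimately show ?thesis unfolding C1_fields_def by auto
qed

lemma coframe_field_in: "coframe_field i \<in> fields 0 1"
proof -
  have "C1_on J (\<lambda>s. coframe_field i s [] (map (G s) js))" if len: "length js = 1" for js
  proof -
    obtain k where k: "js = [k]" using len by (cases js) auto
    show ?thesis
      by (rule C1_on_cong[OF C1_on_const[of _ "if i = k then 1 else 0"]])
         (simp add: k coframe_field_def covector_tensor_def basis_at_in[OF basis] dual_basis_basis[OF basis])
  qed
  moreover have "coframe_field i \<in> tensor_fields \<A> J \<gamma> 0 1"
    unfolding tensor_fields_def coframe_field_def
    using covector_tensor_in[OF dual_basis_in[OF basis] subspace_T] by auto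
  ultimately show ?thesis unfolding C1_fields_def by auto
qed

lemma fields_00:
  assumes "A \<in> fields 0 0"
  obtains f where "C1_on J f" "A = scalar_field J f"
proof
  show "C1_on J (\<lambda>s. A s [] [])" using C1_fields_D(3)[OF assms, of "[]" "[]"] by simp
  have "A s \<omega>s vs = scalar_field J (\<lambda>s. A s [] []) s \<omega>s vs" for s \<omega>s vs
    using C1_fields_D(2)[OF assms, of s] tensor_outside[OF C1_fields_D(1)[OF assms], of s \<omega>s vs]
    by (auto simp: scalar_field_def scalar_tensor_def tuples_def)
  then show "A = scalar_field J (\<lambda>s. A s [] [])" by (intro ext)
qed

lemma derivation_contract_prod:
  assumes D: "derivation_along \<A> J \<gamma> G D" and A: "A \<in> fields p q" and B: "B \<in> fields p' q'"
    and "i < p + p'" "j < q + q'"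
  shows "D (\<lambda>s. contract \<A> (\<gamma> s) i j (tensor_prod p q (A s) (B s))) s \<omega>s vs =
     contract \<A> (\<gamma> s) i j (tensor_prod p q (D A s) (B s)) \<omega>s vs +
     contract \<A> (\<gamma> s) i j (tensor_prod p q (A s) (D B s)) \<omega>s vs"
  by (simp add: derivation_alongD(3)[OF D assms(4,5) tensor_prod_C1_fields[OF frame A B]]
        derivation_alongD(4)[OF D A B] contract_add)

text \<open>For a field \<open>A\<close> and a frame vector \<open>G\<^sub>i\<close>, the contraction \<open>B\<close> of \<open>A \<otimes> G\<^sub>i\<close> has one covariant
  argument less than \<open>A\<close>. In \<open>D B = C (D A \<otimes> G\<^sub>i) + C (A \<otimes> D G\<^sub>i)\<close> the left-hand side and the last term
  are known, hence so is \<open>C (D A \<otimes> G\<^sub>i)\<close>, which is \<open>D A\<close> with \<open>G\<^sub>i\<close> inserted.\<close>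

lemma derivations_agree_covariant_step:
  assumes D: "derivation_along \<A> J \<gamma> G D" "derivation_along \<A> J \<gamma> G D'"
    and agree: "\<And>A. A \<in> fields p q \<Longrightarrow> D A = D' A"
    and frame_agree: "\<And>i. D (frame_field i) = D' (frame_field i)"
    and A: "A \<in> fields p (Suc q)"
  shows "D A = D' A"
proof
  fix s
  note in_fields = derivation_alongD(1)[OF D(1) A] derivation_alongD(1)[OF D(2) A]
  show "D A s = D' A s"
  proof (cases "s \<in> J")
    case s: True
    have DA: "D A s \<in> tensor_space \<A> (\<gamma> s) p (Suc q)" "D' A s \<in> tensor_space \<A> (\<gamma> s) p (Suc q)"
      using in_fields s by (simp_all add: tensor_fields_def)
    show ?thesis
    proof (rule tensor_eqI_co[OF basis[OF s] DA])
      fix i \<omega>s vs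
      let ?B = "\<lambda>s. contract \<A> (\<gamma> s) p 0 (tensor_prod p (Suc q) (A s) (frame_field i s))"
      have "(\<lambda>s. tensor_prod p (Suc q) (A s) (frame_field i s)) \<in> fields (Suc p) (Suc q)"
        using tensor_prod_C1_fields[OF frame A frame_field_in] by simp
      from agree[OF contract_C1_fields[OF frame this, of p 0]] have "D ?B s \<omega>s vs = D' ?B s \<omega>s vs"
        by simp
      then have eq: "contract \<A> (\<gamma> s) p 0 (tensor_prod p (Suc q) (D A s) (frame_field i s)) \<omega>s vs
          = contract \<A> (\<gamma> s) p 0 (tensor_prod p (Suc q) (D' A s) (frame_field i s)) \<omega>s vs"
        by (simp add: derivation_contract_prod[OF D(1) A frame_field_in]
              derivation_contract_prod[OF D(2) A frame_field_in] frame_agree)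
      show "D A s \<omega>s (G s i # vs) = D' A s \<omega>s (G s i # vs)"
      proof (cases "length \<omega>s = p \<and> length vs = q")
        case True
        with eq show ?thesis
          using s contract_with_vector[OF basis[OF s] DA(1) basis_at_in[OF basis[OF s]]]
            contract_with_vector[OF basis[OF s] DA(2) basis_at_in[OF basis[OF s]]]
          by (simp add: vector_field_def)
      next
        case False
        then show ?thesis
          by (subst tensor_outside[OF DA(1)], force simp: tuples_def,
              subst tensor_outside[OF DA(2)], force simp: tuples_def) simp
      qed
    qed
  next
    case False
    then show ?thesis using in_fields by (simp add: tensor_fields_def)
  qed
qed

text \<open>The same argument with the elements of the dual frame removes a contravariant argument.\<close>

lemma derivations_agree_contravariant_step:
  assumes D: "derivation_along \<A> J \<gamma> G D" "derivation_along \<A> J \<gamma> G D'"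
    and agree: "\<And>A. A \<in> fields p q \<Longrightarrow> D A = D' A"
    and coframe_agree: "\<And>i. D (coframe_field i) = D' (coframe_field i)"
    and A: "A \<in> fields (Suc p) q"
  shows "D A = D' A"
proof
  fix s
  note in_fields = derivation_alongD(1)[OF D(1) A] derivation_alongD(1)[OF D(2) A]
  show "D A s = D' A s"
  proof (cases "s \<in> J")
    case s: True
    have DA: "D A s \<in> tensor_space \<A> (\<gamma> s) (Suc p) q" "D' A s \<in> tensor_space \<A> (\<gamma> s) (Suc p) q"
      using in_fields s by (simp_all add: tensor_fields_def)
    show ?thesis
    proof (rule tensor_eqI_contra[OF basis[OF s] DA])
      fix i \<omega>s vs
      let ?B = "\<lambda>s. contract \<A> (\<gamma> s) 0 q (tensor_prod (Suc p) q (A s) (coframe_field i s))"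
      have "(\<lambda>s. tensor_prod (Suc p) q (A s) (coframe_field i s)) \<in> fields (Suc p) (Suc q)"
        using tensor_prod_C1_fields[OF frame A coframe_field_in] by simp
      from agree[OF contract_C1_fields[OF frame this, of 0 q]] have "D ?B s \<omega>s vs = D' ?B s \<omega>s vs"
        by simp
      then have eq: "contract \<A> (\<gamma> s) 0 q (tensor_prod (Suc p) q (D A s) (coframe_field i s)) \<omega>s vs
          = contract \<A> (\<gamma> s) 0 q (tensor_prod (Suc p) q (D' A s) (coframe_field i s)) \<omega>s vs"
        by (simp add: derivation_contract_prod[OF D(1) A coframe_field_in]
              derivation_contract_prod[OF D(2) A coframe_field_in] coframe_agree)
      show "D A s (\<theta> s i # \<omega>s) vs = D' A s (\<theta> s i # \<omega>s) vs"
      proof (cases "length \<omega>s = p \<and> length vs = q")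
        case True
        with eq show ?thesis
          using s contract_with_covector[OF basis[OF s] DA(1) dual_basis_in[OF basis[OF s]]]
            contract_with_covector[OF basis[OF s] DA(2) dual_basis_in[OF basis[OF s]]]
          by (simp add: coframe_field_def)
      next
        case False
        then show ?thesis
          by (subst tensor_outside[OF DA(1)], force simp: tuples_def,
              subst tensor_outside[OF DA(2)], force simp: tuples_def) simp
      qed
    qed
  next
    case False
    then show ?thesis using in_fields by (simp add: tensor_fields_def)
  qed
qed

text \<open>The induction on the number of covariant arguments has to come first. It covers the coframe
  fields, whose type is \<open>(0,1)\<close>, and these are what the induction on the number of contravariant
  arguments inserts.\<close>

lemma derivation_unique:
  assumes D: "derivation_along \<A> J \<gamma> G D" "derivation_along \<A> J \<gamma> G D'"
    and scalar: "\<And>f. C1_on J f \<Longrightarrow> D (scalar_field J f) = D' (scalar_field J f)"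
    and frame_agree: "\<And>i. D (frame_field i) = D' (frame_field i)"
  shows "D = D'"
proof (rule extensionalityI[OF derivation_alongD(5)[OF D(1)] derivation_alongD(5)[OF D(2)]])
  have covariant: "D A = D' A" if "A \<in> fields 0 q" for A q
    using that
  proof (induction q arbitrary: A)
    case 0
    then show ?case using scalar fields_00 by metis
  next
    case (Suc q)
    show ?case by (rule derivations_agree_covariant_step[OF D Suc.IH frame_agree Suc.prems])
  qed
  have "D A = D' A" if "A \<in> fields p q" for A p q
    using that
  proof (induction p arbitrary: A)
    case 0
    then show ?case by (rule covariant)
  next
    case (Suc p)
    show ?case
      by (rule derivations_agree_contravariant_step[OF D Suc.IH covariant[OF coframe_field_in] Suc.prems])
  qed
  then show "D A = D' A" if "A \<in> (\<Union>p q. fields p q)" for A using that by blast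
qed

lemma rescaled_frame:
  assumes f: "C1_on J f" and nz: "\<And>s. s \<in> J \<Longrightarrow> f s \<noteq> 0"
  shows "C1_frame \<A> J \<gamma> G (\<lambda>s i. f s *\<^sub>R G s i)"
    and "vector_field \<A> J \<gamma> (\<lambda>s i. f s *\<^sub>R G s i) i
      = (\<lambda>s. tensor_prod 0 0 (scalar_field J f s) (frame_field i s))"
proof -
  show eq: "vector_field \<A> J \<gamma> (\<lambda>s i. f s *\<^sub>R G s i) i
      = (\<lambda>s. tensor_prod 0 0 (scalar_field J f s) (frame_field i s))" for i
  proof (intro ext)
    fix s and \<omega>s :: "('m, 'n) covec list" and vs :: "('m, 'n) tvec list"
    show "vector_field \<A> J \<gamma> (\<lambda>s i. f s *\<^sub>R G s i) i s \<omega>s vs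
      = tensor_prod 0 0 (scalar_field J f s) (frame_field i s) \<omega>s vs"
    proof (cases "s \<in> J \<and> \<omega>s \<in> tuples (T' s) 1")
      case True
      then obtain \<omega> where "\<omega>s = [\<omega>]" "\<omega> \<in> T' s" by (cases \<omega>s) (auto simp: tuples_def)
      then show ?thesis
        using True real_linear_on_scale[OF subspace_T cotangent_space_linear basis_at_in[OF basis]]
        by (simp add: vector_field_def tensor_prod_def scalar_field_def scalar_tensor_def vector_tensor_def)
    qed (auto simp: vector_field_def tensor_prod_def vector_tensor_def)
  qed
  have "basis_at \<A> (\<gamma> s) (\<lambda>i. f s *\<^sub>R G s i)" if s: "s \<in> J" for s
  proof (rule basis_change(1)[OF basis[OF s]])
    show "mat (f s) ** mat (inverse (f s)) = (mat 1 :: real ^ 'n ^ 'n)"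
      using nz[OF s]
      by (simp add: vec_eq_iff matrix_matrix_mult_def mat_def if_distrib[of "\<lambda>x. _ * x"] cong: if_cong)
    show "f s *\<^sub>R G s j = (\<Sum>i\<in>UNIV. ((mat (f s) :: real ^ 'n ^ 'n) $ i $ j) *\<^sub>R G s i)" for j
      by (simp add: mat_def if_distrib[of "\<lambda>x. x *\<^sub>R _"] cong: if_cong)
  qed
  then show "C1_frame \<A> J \<gamma> G (\<lambda>s i. f s *\<^sub>R G s i)"
    using tensor_prod_C1_fields[OF frame scalar_field_in[OF f] frame_field_in]
    by (simp add: C1_frame_def frame_along_def eq)
qed

lemma C1_frame_self: "C1_frame \<A> J \<gamma> G G"
  unfolding C1_frame_def using frame frame_field_in by blast

text \<open>If \<open>f\<close> has no zeros then \<open>f G\<^sub>i\<close> is again a frame, and \<open>D (f G\<^sub>i) = (D f) G\<^sub>i + f D G\<^sub>i\<close> shows that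
  \<open>D f\<close> is determined by the values of \<open>D\<close> on frames. An arbitrary \<open>f\<close> is a linear combination of the
  functions \<open>1 + (f + 1)\<^sup>2\<close> and \<open>1 + (f - 1)\<^sup>2\<close>, which have no zeros.\<close>

lemma derivations_agree_on_functions:
  assumes D: "derivation_along \<A> J \<gamma> G D" "derivation_along \<A> J \<gamma> G D'"
    and agree: "\<And>F i. C1_frame \<A> J \<gamma> G F \<Longrightarrow> D (vector_field \<A> J \<gamma> F i) = D' (vector_field \<A> J \<gamma> F i)"
    and f: "C1_on J f"
  shows "D (scalar_field J f) = D' (scalar_field J f)"
proof -
  have nonvanishing: "D (scalar_field J g) = D' (scalar_field J g)"
    if g: "C1_on J g" and nz: "\<And>s. s \<in> J \<Longrightarrow> g s \<noteq> 0" for g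
  proof (intro ext)
    fix s \<omega>s vs
    let ?g = "scalar_field J g" and ?i = "undefined :: 'n"
    note g_in = scalar_field_in[OF g]
    have fields: "D ?g \<in> tensor_fields \<A> J \<gamma> 0 0" "D' ?g \<in> tensor_fields \<A> J \<gamma> 0 0"
      using derivation_alongD(1)[OF D(1) g_in] derivation_alongD(1)[OF D(2) g_in] by auto
    have frame_agree: "D (frame_field ?i) = D' (frame_field ?i)" by (rule agree[OF C1_frame_self])
    show "D ?g s \<omega>s vs = D' ?g s \<omega>s vs"
    proof (cases "s \<in> J \<and> \<omega>s = [] \<and> vs = []")
      case True
      have "D (\<lambda>s. tensor_prod 0 0 (?g s) (frame_field ?i s)) s [\<theta> s ?i] []
          = D' (\<lambda>s. tensor_prod 0 0 (?g s) (frame_field ?i s)) s [\<theta> s ?i] []"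
        using agree[OF rescaled_frame(1)[OF g nz], of ?i] by (simp only: rescaled_frame(2)[OF g nz])
      then have "D ?g s [] [] * frame_field ?i s [\<theta> s ?i] [] = D' ?g s [] [] * frame_field ?i s [\<theta> s ?i] []"
        unfolding derivation_alongD(4)[OF D(1) g_in frame_field_in]
          derivation_alongD(4)[OF D(2) g_in frame_field_in]
        by (simp add: frame_agree tensor_prod_def)
      moreover have "frame_field ?i s [\<theta> s ?i] [] = 1"
        using True by (simp add: vector_field_def vector_tensor_apply dual_basis_in[OF basis]
            dual_basis_basis[OF basis])
      ultimately show ?thesis using True by simp
    next
      case False
      have "A s \<omega>s vs = 0" if "A \<in> tensor_fields \<A> J \<gamma> 0 0" for A
        using that False tensor_outside[of "A s" \<A> "\<gamma> s" 0 0 \<omega>s vs]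
        by (cases "s \<in> J") (auto simp: tensor_fields_def tuples_def)
      from this[OF fields(1)] this[OF fields(2)] show ?thesis by simp
    qed
  qed
  \<comment> \<open>The difference of these two functions is \<open>4 f\<close>.\<close>
  let ?u = "\<lambda>s. 1 + (f s + 1) * (f s + 1)" and ?v = "\<lambda>s. 1 + (f s + (-1)) * (f s + (-1))"
  have C1: "C1_on J ?u" "C1_on J ?v" by (intro C1_on_add C1_on_mult C1_on_const f)+
  have nz: "?u s \<noteq> 0" "?v s \<noteq> 0" for s
    using zero_le_square[of "f s + 1"] zero_le_square[of "f s + (-1)"] by linarith+
  have "scalar_field J f = (1/4) *\<^sub>R scalar_field J ?u + (-1/4) *\<^sub>R (scalar_field J ?v :: ('m,'n) tensor_field)"
    by (simp add: fun_eq_iff scalar_field_def scalar_tensor_def field_simps)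
  then show ?thesis
    by (simp only: derivation_alongD(2)[OF D(1) scalar_field_in[OF C1(1)] scalar_field_in[OF C1(2)]]
          derivation_alongD(2)[OF D(2) scalar_field_in[OF C1(1)] scalar_field_in[OF C1(2)]]
          nonvanishing[OF C1(1) nz(1)] nonvanishing[OF C1(2) nz(2)])
qed

end

section \<open>The components of a transport\<close>

lemma S_transportD:
  assumes "S_transport \<A> J \<gamma> S" and "s \<in> J" "t \<in> J"
  shows "A \<in> tensor_space \<A> (\<gamma> s) p q \<Longrightarrow> S s t A \<in> tensor_space \<A> (\<gamma> t) p q"
    and "real_linear_on (tensor_space \<A> (\<gamma> s) p q) (S s t)"
    and "r \<in> J \<Longrightarrow> A \<in> tensor_space \<A> (\<gamma> s) p q \<Longrightarrow> S t r (S s t A) = S s r A"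
    and "A \<in> tensor_space \<A> (\<gamma> s) p q \<Longrightarrow> S s s A = A"
proof -
  note S = assms(1)[unfolded S_transport_def]
  show "A \<in> tensor_space \<A> (\<gamma> s) p q \<Longrightarrow> S s t A \<in> tensor_space \<A> (\<gamma> t) p q"
    using S[THEN conjunct1] assms(2,3) by blast
  show "real_linear_on (tensor_space \<A> (\<gamma> s) p q) (S s t)"
    by (rule S[THEN conjunct2, THEN conjunct1, rule_format, OF assms(2,3)])
  show "r \<in> J \<Longrightarrow> A \<in> tensor_space \<A> (\<gamma> s) p q \<Longrightarrow> S t r (S s t A) = S s r A"
    by (rule S[THEN conjunct2, THEN conjunct2, THEN conjunct2, THEN conjunct2, THEN conjunct1,
          rule_format, OF assms(2,3)])
  show "A \<in> tensor_space \<A> (\<gamma> s) p q \<Longrightarrow> S s s A = A"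
    by (rule S[THEN conjunct2, THEN conjunct2, THEN conjunct2, THEN conjunct2, THEN conjunct2,
          rule_format, OF assms(2)])
qed

text \<open>The matrix exists since every tensor of type \<open>(1,0)\<close> is a combination of basis vectors;
  evaluating on the dual basis recovers its entries.\<close>

lemma transport_matrix_works:
  assumes f: "basis_at \<A> (\<gamma> t) (F t)"
    and S: "\<And>j. S s t (vector_tensor \<A> (\<gamma> s) (F s j)) \<in> tensor_space \<A> (\<gamma> t) 1 0"
  shows "transport_matrix \<A> \<gamma> F S t s $ i $ j
      = S s t (vector_tensor \<A> (\<gamma> s) (F s j)) [dual_basis \<A> (\<gamma> t) (F t) i] []"
    and "S s t (vector_tensor \<A> (\<gamma> s) (F s j))
      = (\<Sum>i\<in>UNIV. (transport_matrix \<A> \<gamma> F S t s $ i $ j) *\<^sub>R vector_tensor \<A> (\<gamma> t) (F t i))"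
proof -
  let ?v = "\<lambda>j. S s t (vector_tensor \<A> (\<gamma> s) (F s j))"
  let ?H = "(\<chi> i j. ?v j [dual_basis \<A> (\<gamma> t) (F t) i] []) :: real ^ 'b ^ 'b"
  have "transport_matrix \<A> \<gamma> F S t s = ?H"
    unfolding transport_matrix_def
  proof (rule the_equality)
    show "\<forall>j. ?v j = (\<Sum>i\<in>UNIV. (?H $ i $ j) *\<^sub>R vector_tensor \<A> (\<gamma> t) (F t i))"
      using tensor_10_expansion[OF f S] by simp
  next
    fix H :: "real ^ 'b ^ 'b"
    assume H: "\<forall>j. ?v j = (\<Sum>i\<in>UNIV. (H $ i $ j) *\<^sub>R vector_tensor \<A> (\<gamma> t) (F t i))"
    show "H = ?H"
      by (simp add: vec_eq_iff H sum_fun_apply vector_tensor_apply[OF dual_basis_in[OF f]]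
            dual_basis_basis[OF f])
  qed
  then show "transport_matrix \<A> \<gamma> F S t s $ i $ j = ?v j [dual_basis \<A> (\<gamma> t) (F t) i] []"
    and "?v j = (\<Sum>i\<in>UNIV. (transport_matrix \<A> \<gamma> F S t s $ i $ j) *\<^sub>R vector_tensor \<A> (\<gamma> t) (F t i))"
    using tensor_10_expansion[OF f S] by simp_all
qed

context frame_on_interval
begin

lemma transport_of_parallel_frame:
  assumes S: "S_transport \<A> J \<gamma> S"
    and parallel: "\<And>s t k. s \<in> J \<Longrightarrow> t \<in> J \<Longrightarrow>
      S s t (vector_tensor \<A> (\<gamma> s) (G s k)) = vector_tensor \<A> (\<gamma> t) (G t k)"
    and s: "s \<in> J" and t: "t \<in> J" and v: "v \<in> T s"
  shows "S s t (vector_tensor \<A> (\<gamma> s) v) = vector_tensor \<A> (\<gamma> t) (shift_vector s t v)"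
proof -
  note lin = S_transportD(2)[OF S s t, where p = 1 and q = 0]
  have "S s t (vector_tensor \<A> (\<gamma> s) v)
      = S s t (\<Sum>k\<in>UNIV. \<theta> s k v *\<^sub>R vector_tensor \<A> (\<gamma> s) (G s k))"
    using vector_expansion[OF basis[OF s] v] vector_tensor_sum[where c = "\<lambda>k. \<theta> s k v" and v = "G s",
        OF basis[OF s] basis_at_in[OF basis[OF s]]]
    by simp
  also have "\<dots> = (\<Sum>k\<in>UNIV. \<theta> s k v *\<^sub>R vector_tensor \<A> (\<gamma> t) (G t k))"
    unfolding parallel[OF s t, symmetric]
    by (rule real_linear_on_sum[OF subspace_tensor_space lin vector_tensor_in])
  also have "\<dots> = vector_tensor \<A> (\<gamma> t) (shift_vector s t v)"
    unfolding shift_vector_def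
    by (rule vector_tensor_sum[OF basis[OF t] basis_at_in[OF basis[OF t]], symmetric])
  finally show ?thesis .
qed

text \<open>If \<open>G\<close> is parallel for the transport, the entries \<open>H\<^sup>k\<^sub>i(s,t)\<close> of the transport matrix in any
  frame \<open>F\<close> of class \<open>C\<^sup>1\<close> are the shifted values of the field \<open>F\<^sub>i\<close> on the dual basis at \<open>\<gamma>(s)\<close>.
  Their derivatives at \<open>t = s\<close>, which are the components of the transport, are therefore by
  definition the components of the derivative of \<open>F\<^sub>i\<close>.\<close>

lemma frame_derivation_generates:
  assumes S: "S_transport \<A> J \<gamma> S"
    and parallel: "\<And>s t k. s \<in> J \<Longrightarrow> t \<in> J \<Longrightarrow>
      S s t (vector_tensor \<A> (\<gamma> s) (G s k)) = vector_tensor \<A> (\<gamma> t) (G t k)"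
    and F: "C1_frame \<A> J \<gamma> G F"
  shows "generates_components \<A> J \<gamma> S F frame_derivation"
  unfolding generates_components_def
proof (intro allI ballI)
  fix i s assume s: "s \<in> J"
  have f: "basis_at \<A> (\<gamma> t) (F t)" if "t \<in> J" for t
    using F that by (simp add: C1_frame_def frame_along_def)
  have F_in: "vector_field \<A> J \<gamma> F i \<in> fields 1 0" for i using F by (simp add: C1_frame_def)
  let ?\<phi> = "\<lambda>k. dual_basis \<A> (\<gamma> s) (F s) k"
  let ?D = "\<lambda>i k. frame_derivative (vector_field \<A> J \<gamma> F i) s [?\<phi> k] []"
  have \<phi>: "?\<phi> k \<in> T' s" for k by (rule dual_basis_in[OF f[OF s]])
  have entry: "transport_matrix \<A> \<gamma> F S s t $ k $ i
      = shifted_value (vector_field \<A> J \<gamma> F i) s [?\<phi> k] [] t" if t: "t \<in> J" for t k i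
  proof -
    have Fi: "F t i \<in> T t" for i by (rule basis_at_in[OF f[OF t]])
    note transport = transport_of_parallel_frame[OF S parallel t s Fi]
    have "transport_matrix \<A> \<gamma> F S s t $ k $ i = S t s (vector_tensor \<A> (\<gamma> t) (F t i)) [?\<phi> k] []"
      by (intro transport_matrix_works(1) f[OF s] S_transportD(1)[OF S t s] vector_tensor_in)
    also have "\<dots> = ?\<phi> k (shift_vector t s (F t i))"
      by (simp add: transport vector_tensor_apply[OF \<phi>])
    also have "\<dots> = shift_covector s t (?\<phi> k) (F t i)"
      by (rule shift_covector_apply[OF t s \<phi> Fi, symmetric])
    also have "\<dots> = shifted_value (vector_field \<A> J \<gamma> F i) s [?\<phi> k] [] t"
      using t by (simp add: vector_field_def vector_tensor_apply shift_covector_in)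
    finally show ?thesis .
  qed
  have "(transport_matrix \<A> \<gamma> F S s has_vector_derivative (\<chi> k i. ?D i k)) (at s within J)"
  proof (rule has_vector_derivative_matrixI)
    fix k i
    have "((\<lambda>t. transport_matrix \<A> \<gamma> F S s t $ k $ i) has_vector_derivative ?D i k) (at s within J)"
      by (rule has_vector_derivative_transform[OF s entry frame_derivative_has_derivative[OF F_in s]])
         (use \<phi> in auto)
    then show "((\<lambda>t. transport_matrix \<A> \<gamma> F S s t $ k $ i) has_vector_derivative
        (\<chi> k i. ?D i k) $ k $ i) (at s within J)" by simp
  qed
  then have "transport_components \<A> J \<gamma> F S s = (\<chi> k i. ?D i k)"
    unfolding transport_components_def by (rule vector_derivative_within[OF not_isolated[OF s]])
  moreover have "frame_derivative (vector_field \<A> J \<gamma> F i) s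
      = (\<Sum>k\<in>UNIV. ?D i k *\<^sub>R vector_tensor \<A> (\<gamma> s) (F s k))"
    using frame_derivative_in[OF F_in, of i] s
    by (intro tensor_10_expansion[OF f[OF s]]) (simp add: tensor_fields_def)
  ultimately show "frame_derivation (vector_field \<A> J \<gamma> F i) s
      = (\<Sum>k\<in>UNIV. (transport_components \<A> J \<gamma> F S s $ k $ i) *\<^sub>R vector_field \<A> J \<gamma> F k s)"
    unfolding frame_derivation_eq[OF F_in] using s by (simp add: vector_field_def)
qed

lemma generates_same_components:
  assumes D: "derivation_along \<A> J \<gamma> G D" "derivation_along \<A> J \<gamma> G D'"
    and F: "C1_frame \<A> J \<gamma> G F"
    and gen: "generates_components \<A> J \<gamma> S F D" "generates_components \<A> J \<gamma> S F D'"
  shows "D (vector_field \<A> J \<gamma> F i) = D' (vector_field \<A> J \<gamma> F i)"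
proof
  fix s
  have F_in: "vector_field \<A> J \<gamma> F i \<in> fields 1 0" using F by (simp add: C1_frame_def)
  show "D (vector_field \<A> J \<gamma> F i) s = D' (vector_field \<A> J \<gamma> F i) s"
  proof (cases "s \<in> J")
    case True
    then show ?thesis using gen by (simp add: generates_components_def)
  next
    case False
    then show ?thesis
      using derivation_alongD(1)[OF D(1) F_in] derivation_alongD(1)[OF D(2) F_in]
      by (simp add: tensor_fields_def)
  qed
qed

end

text \<open>Transporting the basis at one point \<open>\<gamma>(s\<^sub>0)\<close> along the path gives a parallel frame. Its matrix
  with respect to \<open>E\<close> is \<open>H(s,s\<^sub>0)\<close>, of class \<open>C\<^sup>1\<close> in \<open>s\<close> and inverse to \<open>H(s\<^sub>0,s)\<close>, so that both
  frames have the same fields of class \<open>C\<^sup>1\<close>.\<close>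

lemma parallel_frame_exists:
  assumes E: "frame_along \<A> J \<gamma> E" and S: "C1_transport \<A> J \<gamma> E S" and s0: "s0 \<in> J"
  obtains G where "frame_along \<A> J \<gamma> G" "C1_fields \<A> J \<gamma> G = C1_fields \<A> J \<gamma> E"
    "\<And>s t k. s \<in> J \<Longrightarrow> t \<in> J \<Longrightarrow>
      S s t (vector_tensor \<A> (\<gamma> s) (G s k)) = vector_tensor \<A> (\<gamma> t) (G t k)"
proof -
  have e: "basis_at \<A> (\<gamma> s) (E s)" if "s \<in> J" for s using E that by (simp add: frame_along_def)
  have T: "S_transport \<A> J \<gamma> S" and C1: "C1_on J (\<lambda>t. transport_matrix \<A> \<gamma> E S t s0)"
    using S s0 by (auto simp: C1_transport_def)
  note S_in = S_transportD(1)[OF T] and S_lin = S_transportD(2)[OF T]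
    and S_comp = S_transportD(3)[OF T] and S_id = S_transportD(4)[OF T]
  let ?v = "\<lambda>s j. vector_tensor \<A> (\<gamma> s) (E s j)"
  let ?H = "\<lambda>t s. transport_matrix \<A> \<gamma> E S t s"
  define G where "G s j = (\<Sum>i\<in>UNIV. (?H s s0 $ i $ j) *\<^sub>R E s i)" for s j
  have H: "S s t (?v s j) = (\<Sum>i\<in>UNIV. (?H t s $ i $ j) *\<^sub>R ?v t i)" if "s \<in> J" "t \<in> J" for s t j
    using that by (intro transport_matrix_works(2)[OF e S_in] vector_tensor_in)
  have inverse: "?H s s0 ** ?H s0 s = mat 1" if s: "s \<in> J" for s
  proof -
    have "(?H s s0 ** ?H s0 s) $ i $ j = (if i = j then 1 else 0)" for i j
    proof -
      have "?v s j = S s0 s (S s s0 (?v s j))"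
        using S_comp[OF s s0 s vector_tensor_in] S_id[OF s s vector_tensor_in] by simp
      also have "\<dots> = (\<Sum>k\<in>UNIV. (?H s0 s $ k $ j) *\<^sub>R S s0 s (?v s0 k))"
        unfolding H[OF s s0]
        by (rule real_linear_on_sum[OF subspace_tensor_space S_lin[OF s0 s] vector_tensor_in])
      finally have "?v s j [dual_basis \<A> (\<gamma> s) (E s) i] []
          = (\<Sum>k\<in>UNIV. (?H s0 s $ k $ j) *\<^sub>R S s0 s (?v s0 k)) [dual_basis \<A> (\<gamma> s) (E s) i] []"
        by (rule arg_cong)
      then show ?thesis
        by (simp add: H[OF s0 s] sum_fun_apply vector_tensor_apply[OF dual_basis_in[OF e[OF s]]]
            dual_basis_basis[OF e[OF s]] matrix_matrix_mult_def mult.commute)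
    qed
    then show ?thesis by (simp add: vec_eq_iff mat_def)
  qed
  have vG: "vector_tensor \<A> (\<gamma> s) (G s j) = S s0 s (?v s0 j)" if s: "s \<in> J" for s j
    unfolding G_def H[OF s0 s] by (rule vector_tensor_sum[OF e[OF s] basis_at_in[OF e[OF s]]])
  show thesis
  proof (rule that)
    note change = C1_fields_change[OF E inverse C1_on_entry[OF C1] G_def]
    show "frame_along \<A> J \<gamma> G" "C1_fields \<A> J \<gamma> G = C1_fields \<A> J \<gamma> E"
      by (rule change; assumption)+
    show "S s t (vector_tensor \<A> (\<gamma> s) (G s k)) = vector_tensor \<A> (\<gamma> t) (G t k)"
      if "s \<in> J" "t \<in> J" for s t k
      using that by (simp add: vG S_comp[OF s0 _ _ vector_tensor_in])
  qed
qed

theorem proposition3p6: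
  fixes X :: "'m topology" and \<A> :: "('m, 'n::finite) chart set"
    and J :: "real set" and \<gamma> :: "real \<Rightarrow> 'm"
    and E :: "real \<Rightarrow> 'n \<Rightarrow> ('m, 'n) tvec"
    and S :: "real \<Rightarrow> real \<Rightarrow> ('m, 'n) tensor \<Rightarrow> ('m, 'n) tensor"
  assumes "C1_manifold X \<A>"
    and "is_interval J" and "interior J \<noteq> {}"
    and "C1_path X \<A> J \<gamma>"
    and "frame_along \<A> J \<gamma> E"
    and "C1_transport \<A> J \<gamma> E S"
  shows "(\<exists>!D. derivation_along \<A> J \<gamma> E D \<and>
               (\<forall>F. C1_frame \<A> J \<gamma> E F \<longrightarrow> generates_components \<A> J \<gamma> S F D))
       \<and> (\<exists>!D. derivation_along \<A> J \<gamma> E D \<and> differentiates_functions J D \<and>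
               generates_components \<A> J \<gamma> S E D)"
proof -
  have not_isolated: "at s within J \<noteq> bot" if "s \<in> J" for s
    by (rule interval_not_isolated[OF assms(2,3) that])
  obtain s0 where "s0 \<in> J" using assms(3) interior_subset by blast
  then obtain G where G: "frame_along \<A> J \<gamma> G" "C1_fields \<A> J \<gamma> G = C1_fields \<A> J \<gamma> E"
    and parallel: "\<And>s t k. s \<in> J \<Longrightarrow> t \<in> J \<Longrightarrow>
      S s t (vector_tensor \<A> (\<gamma> s) (G s k)) = vector_tensor \<A> (\<gamma> t) (G t k)"
    using parallel_frame_exists[OF assms(5,6)] by metis
  interpret G: frame_on_interval \<A> J \<gamma> G using G(1) not_isolated by unfold_locales
  interpret E: frame_on_interval \<A> J \<gamma> E using assms(5) not_isolated by unfold_locales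
  let ?D = "G.frame_derivation"
  have derivation: "derivation_along \<A> J \<gamma> E ?D"
    using G.frame_derivation_derivation unfolding derivation_along_def G(2) .
  have "C1_frame \<A> J \<gamma> G = C1_frame \<A> J \<gamma> E"
    by (intro ext) (simp only: C1_frame_def G(2))
  then have generates: "generates_components \<A> J \<gamma> S F ?D" if "C1_frame \<A> J \<gamma> E F" for F
    using G.frame_derivation_generates[OF _ parallel] assms(6) that by (simp add: C1_transport_def)
  have "D = ?D" if D: "derivation_along \<A> J \<gamma> E D"
    and gen: "\<And>F. C1_frame \<A> J \<gamma> E F \<Longrightarrow> generates_components \<A> J \<gamma> S F D" for D
  proof (rule E.derivation_unique[OF D derivation])
    have agree: "D (vector_field \<A> J \<gamma> F i) = ?D (vector_field \<A> J \<gamma> F i)"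
      if F: "C1_frame \<A> J \<gamma> E F" for F i
      by (rule E.generates_same_components[OF D derivation F gen[OF F] generates[OF F]])
    show "D (vector_field \<A> J \<gamma> E i) = ?D (vector_field \<A> J \<gamma> E i)" for i
      by (rule agree[OF E.C1_frame_self])
    show "D (scalar_field J f) = ?D (scalar_field J f)" if "C1_on J f" for f
      by (rule E.derivations_agree_on_functions[OF D derivation agree that])
  qed
  moreover have "D = ?D" if D: "derivation_along \<A> J \<gamma> E D" and "differentiates_functions J D"
    and gen: "generates_components \<A> J \<gamma> S E D" for D
  proof (rule E.derivation_unique[OF D derivation])
    show "D (vector_field \<A> J \<gamma> E i) = ?D (vector_field \<A> J \<gamma> E i)" for i
      by (rule E.generates_same_components[OF D derivation E.C1_frame_self gen
            generates[OF E.C1_frame_self]])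
    show "D (scalar_field J f) = ?D (scalar_field J f)" if "C1_on J f" for f
      using that \<open>differentiates_functions J D\<close> G.frame_derivation_differentiates
      by (simp add: differentiates_functions_def)
  qed
  ultimately show ?thesis
    using derivation generates generates[OF E.C1_frame_self] G.frame_derivation_differentiates
    by (intro conjI ex1I[of _ ?D]) blast+
qed

end
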